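(* Let $\{X_i\}_{i\in\mathbb{N}}$ be a sequence of Banach spaces, let $X=\left[\bigoplus X_i\right]_{c_0}$ be their $c_0$-sum, and let $\delta_i(\varepsilon)$ be the modulus of convexity of $X_i^*$. Suppose that each $X_i$ is separable and that $\inf_i\delta_i(\varepsilon)>0$ for all $0<\varepsilon<1$. Then $X^*$ admits a uniformly simultaneously continuous retraction.
   Context: Banach spaces are real or complex. $B_{X^*}$ is the closed unit ball of $X^*$. $X^*$ is said to admit a uniformly simultaneously continuous retraction if there is a map $r:X^*\to B_{X^*}$ which is the identity on $B_{X^*}$, is weak-$*$ continuous (weak-$*$ to weak-$*$), and is uniformly continuous in the norm. The modulus of convexity of a Banach space $Z$ with unit sphere $S_Z$ is $$\delta_Z(\varepsilon)=\inf\left\{1-\left\|\frac{x+y}{2}\right\| : x,y\in S_Z,\ \|x-y\|\ge\varepsilon\right\}.$$ *)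

theory Defs
  imports "HOL-Analysis.Analysis" "HOL-Library.Function_Algebras"
begin

text \<open>
  The Banach spaces of a sequence must be allowed to differ from one another, so a normed space
  is a value and not a type: a linear subspace \<open>carr\<close> of an ambient vector space (the type
  \<open>'v\<close> with its addition and the scalar multiplication \<open>smul\<close>), with a norm on that subspace.
  Every sequence of normed spaces over the same field has this form up to isometric isomorphism,
  with the algebraic direct sum of the spaces as ambient vector space. The scalar field \<open>'k\<close>
  is used with \<open>'k = real\<close> and \<open>'k = complex\<close>. Values of \<open>nrm\<close> outside \<open>carr\<close> carry no meaning.
\<close>

record ('k, 'v) nspace =
  carr :: "'v set"
  smul :: "'k \<Rightarrow> 'v \<Rightarrow> 'v"
  nrm :: "'v \<Rightarrow> real"

definition normed_space :: "('k::real_normed_field, 'v::ab_group_add) nspace \<Rightarrow> bool" where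
  "normed_space X \<longleftrightarrow>
     vector_space (smul X) \<and> module.subspace (smul X) (carr X) \<and>
     (\<forall>x\<in>carr X. 0 \<le> nrm X x) \<and>
     (\<forall>x\<in>carr X. nrm X x = 0 \<longleftrightarrow> x = 0) \<and>
     (\<forall>c. \<forall>x\<in>carr X. nrm X (smul X c x) = norm c * nrm X x) \<and>
     (\<forall>x\<in>carr X. \<forall>y\<in>carr X. nrm X (x + y) \<le> nrm X x + nrm X y)"

text \<open>
  The library's metric spaces ask for a distance that is nonnegative and symmetric on the whole
  type, hence the value 0 off the carrier.
\<close>

definition ndist :: "('k, 'v::ab_group_add) nspace \<Rightarrow> 'v \<Rightarrow> 'v \<Rightarrow> real" where
  "ndist X x y = (if x \<in> carr X \<and> y \<in> carr X then nrm X (x - y) else 0)"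

definition norm_metric :: "('k, 'v::ab_group_add) nspace \<Rightarrow> 'v metric" where
  "norm_metric X = metric (carr X, ndist X)"

definition banach_space :: "('k::real_normed_field, 'v::ab_group_add) nspace \<Rightarrow> bool" where
  "banach_space X \<longleftrightarrow> normed_space X \<and> mcomplete_of (norm_metric X)"

definition separable_nspace :: "('k, 'v::ab_group_add) nspace \<Rightarrow> bool" where
  "separable_nspace X \<longleftrightarrow> separable_space (mtopology_of (norm_metric X))"

definition closed_unit_ball :: "('k, 'v) nspace \<Rightarrow> 'v set" where
  "closed_unit_ball X = {x \<in> carr X. nrm X x \<le> 1}"

definition unit_sphere :: "('k, 'v) nspace \<Rightarrow> 'v set" where
  "unit_sphere X = {x \<in> carr X. nrm X x = 1}"

definition bounded_functional ::
  "('k::real_normed_field, 'v::ab_group_add) nspace \<Rightarrow> ('v \<Rightarrow> 'k) \<Rightarrow> bool" where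
  "bounded_functional X f \<longleftrightarrow>
     (\<forall>x\<in>carr X. \<forall>y\<in>carr X. f (x + y) = f x + f y) \<and>
     (\<forall>c. \<forall>x\<in>carr X. f (smul X c x) = c * f x) \<and>
     (\<exists>K. \<forall>x\<in>carr X. norm (f x) \<le> K * nrm X x)"

text \<open>
  Functionals are set to 0 off the carrier, so that equal functionals are equal functions.
\<close>

definition dual ::
  "('k::real_normed_field, 'v::ab_group_add) nspace \<Rightarrow> ('k, 'v \<Rightarrow> 'k) nspace" where
  "dual X =
     \<lparr> carr = {f. bounded_functional X f \<and> (\<forall>x. x \<notin> carr X \<longrightarrow> f x = 0)},
       smul = (\<lambda>c f x. c * f x),
       nrm = (\<lambda>f. SUP x\<in>closed_unit_ball X. norm (f x)) \<rparr>"

text \<open>The coarsest topology on the dual making all evaluations at points of the space continuous.\<close>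

definition weak_star ::
  "('k::real_normed_field, 'v::ab_group_add) nspace \<Rightarrow> ('v \<Rightarrow> 'k) topology" where
  "weak_star X =
     topology_generated_by {{f \<in> carr (dual X). f x \<in> U} | x U. x \<in> carr X \<and> open U}"

definition c0_sum ::
  "(nat \<Rightarrow> ('k, 'v::ab_group_add) nspace) \<Rightarrow> ('k, nat \<Rightarrow> 'v) nspace" where
  "c0_sum X =
     \<lparr> carr = {x. (\<forall>i. x i \<in> carr (X i)) \<and> (\<lambda>i. nrm (X i) (x i)) \<longlonglongrightarrow> 0},
       smul = (\<lambda>c x i. smul (X i) c (x i)),
       nrm = (\<lambda>x. SUP i. nrm (X i) (x i)) \<rparr>"

text \<open>
  Extended reals, so that the infimum over the empty set (e.g. for the zero space) is \<open>\<infinity>\<close>.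
\<close>

definition modulus_of_convexity ::
  "('k::real_normed_field, 'v::ab_group_add) nspace \<Rightarrow> real \<Rightarrow> ereal" where
  "modulus_of_convexity Z \<epsilon> =
     Inf {ereal (1 - nrm Z (smul Z (1 / 2) (x + y))) | x y.
            x \<in> unit_sphere Z \<and> y \<in> unit_sphere Z \<and> \<epsilon> \<le> nrm Z (x - y)}"

text \<open>
  The argument is the predual, since the weak-* topology of the dual depends on it.
\<close>

definition dual_admits_usc_retraction ::
  "('k::real_normed_field, 'v::ab_group_add) nspace \<Rightarrow> bool" where
  "dual_admits_usc_retraction X \<longleftrightarrow>
     (\<exists>r. r \<in> carr (dual X) \<rightarrow> closed_unit_ball (dual X) \<and>
          (\<forall>f\<in>closed_unit_ball (dual X). r f = f) \<and>
          continuous_map (weak_star X) (weak_star X) r \<and>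
          uniformly_continuous_map (norm_metric (dual X)) (norm_metric (dual X)) r)"

lemma module_smul: "normed_space X \<Longrightarrow> module (smul X)"
  by (simp add: normed_space_def module_iff_vector_space)

lemma Metric_space_ndist:
  assumes "normed_space X"
  shows "Metric_space (carr X) (ndist X)"
proof -
  interpret vector_space "smul X" using assms by (simp add: normed_space_def)
  have sub: "subspace (carr X)" using assms by (simp add: normed_space_def)
  have d: "x - y \<in> carr X" if "x \<in> carr X" "y \<in> carr X" for x y
    using sub that by (rule subspace_diff)
  have sym: "nrm X (x - y) = nrm X (y - x)" if "x \<in> carr X" "y \<in> carr X" for x y
  proof -
    have "nrm X (smul X (-1) (y - x)) = norm (-1 :: 'a) * nrm X (y - x)"
      using assms d[OF that(2,1)] unfolding normed_space_def by blast
    then show ?thesis by simp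
  qed
  have tri: "nrm X (u + v) \<le> nrm X u + nrm X v" if "u \<in> carr X" "v \<in> carr X" for u v
    using assms that by (simp add: normed_space_def)
  show ?thesis
  proof
    fix x y z
    show "0 \<le> ndist X x y"
      using assms d by (auto simp: ndist_def normed_space_def)
    show "ndist X x y = ndist X y x"
      using sym by (auto simp: ndist_def)
    show "ndist X x y = 0 \<longleftrightarrow> x = y" if "x \<in> carr X" "y \<in> carr X"
      using assms d[OF that] that by (auto simp: ndist_def normed_space_def)
    assume *: "x \<in> carr X" "y \<in> carr X" "z \<in> carr X"
    have "nrm X ((x - y) + (y - z)) \<le> nrm X (x - y) + nrm X (y - z)"
      using tri[OF d[OF *(1,2)] d[OF *(2,3)]] .
    then show "ndist X x z \<le> ndist X x y + ndist X y z"
      using * by (simp add: ndist_def)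
  qed
qed

lemma norm_metric_simps:
  assumes "normed_space X"
  shows "mspace (norm_metric X) = carr X" "mdist (norm_metric X) = ndist X"
  using Metric_space_ndist[OF assms]
  by (simp_all add: norm_metric_def Metric_space.mspace_metric Metric_space.mdist_metric)

lemma topspace_weak_star:
  assumes "normed_space X"
  shows "topspace (weak_star X) = carr (dual X)"
proof -
  have "0 \<in> carr X"
    using assms module.subspace_0[OF module_smul[OF assms]] by (simp add: normed_space_def)
  then have "carr (dual X) \<in> {{f \<in> carr (dual X). f x \<in> U} | x U. x \<in> carr X \<and> open U}"
    by (intro CollectI exI[of _ 0] exI[of _ UNIV]) simp
  then show ?thesis
    unfolding weak_star_def topology_generated_by_topspace by blast
qed

lemma normed_space_0: "normed_space X \<Longrightarrow> 0 \<in> carr X \<and> nrm X 0 = 0"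
  using module.subspace_0[OF module_smul] by (auto simp: normed_space_def)

lemma dual_norm_upper:
  assumes X: "normed_space X" and f: "f \<in> carr (dual X)"
  shows "bdd_above ((\<lambda>x. norm (f x)) ` closed_unit_ball X)"
    and "x \<in> closed_unit_ball X \<Longrightarrow> norm (f x) \<le> nrm (dual X) f"
    and "0 \<le> nrm (dual X) f"
proof -
  obtain K where K: "\<And>x. x \<in> carr X \<Longrightarrow> norm (f x) \<le> K * nrm X x"
    using f unfolding dual_def bounded_functional_def by fastforce
  have "norm (f x) \<le> \<bar>K\<bar>" if "x \<in> closed_unit_ball X" for x
  proof -
    have x: "x \<in> carr X" "0 \<le> nrm X x" "nrm X x \<le> 1"
      using that X by (auto simp: closed_unit_ball_def normed_space_def)
    have "K * nrm X x \<le> \<bar>K\<bar> * 1"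
      using x by (intro mult_mono) auto
    then show ?thesis using K[OF x(1)] by simp
  qed
  then show bdd: "bdd_above ((\<lambda>x. norm (f x)) ` closed_unit_ball X)"
    by (meson bdd_aboveI2)
  show up: "norm (f x) \<le> nrm (dual X) f" if "x \<in> closed_unit_ball X" for x
    using cSUP_upper[OF that bdd] by (simp add: dual_def)
  have "0 \<in> closed_unit_ball X"
    using normed_space_0[OF X] by (simp add: closed_unit_ball_def)
  from up[OF this] show "0 \<le> nrm (dual X) f"
    using norm_ge_zero order_trans by blast
qed

lemma dual_norm_least:
  assumes X: "normed_space X" and "\<And>x. x \<in> closed_unit_ball X \<Longrightarrow> norm (f x) \<le> K"
  shows "nrm (dual X) f \<le> K"
proof -
  have "closed_unit_ball X \<noteq> {}"
    using normed_space_0[OF X] by (auto simp: closed_unit_ball_def)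
  then show ?thesis using assms(2) by (auto simp: dual_def intro: cSUP_least)
qed

lemma normed_space_dual:
  fixes X :: "('k::real_normed_field, 'v::ab_group_add) nspace"
  assumes X: "normed_space X"
  shows "normed_space (dual X)"
proof -
  interpret vector_space "smul X" using X by (simp add: normed_space_def)
  have sub: "subspace (carr X)" using X by (simp add: normed_space_def)
  have vs: "vector_space (smul (dual X))"
    by unfold_locales (auto simp: dual_def fun_eq_iff algebra_simps)
  interpret D: vector_space "smul (dual X)" by (rule vs)
  have subD: "D.subspace (carr (dual X))"
  proof (rule D.subspaceI)
    show "0 \<in> carr (dual X)"
      by (auto simp: dual_def bounded_functional_def intro!: exI[of _ 0])
    show "f + g \<in> carr (dual X)" if fg: "f \<in> carr (dual X)" "g \<in> carr (dual X)" for f g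
    proof -
      obtain K where "\<And>x. x \<in> carr X \<Longrightarrow> norm (f x) \<le> K * nrm X x"
        using fg(1) unfolding dual_def bounded_functional_def by fastforce
      moreover obtain L where "\<And>x. x \<in> carr X \<Longrightarrow> norm (g x) \<le> L * nrm X x"
        using fg(2) unfolding dual_def bounded_functional_def by fastforce
      ultimately have "\<forall>x\<in>carr X. norm ((f + g) x) \<le> (K + L) * nrm X x"
        by (auto simp: distrib_right intro: order_trans[OF norm_triangle_ineq] add_mono)
      then have "\<exists>K. \<forall>x\<in>carr X. norm ((f + g) x) \<le> K * nrm X x" ..
      then show ?thesis
        using that by (simp add: dual_def bounded_functional_def algebra_simps)
    qed
    show "smul (dual X) c f \<in> carr (dual X)" if f: "f \<in> carr (dual X)" for c f
    proof -
      obtain K where "\<And>x. x \<in> carr X \<Longrightarrow> norm (f x) \<le> K * nrm X x"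
        using f unfolding dual_def bounded_functional_def by fastforce
      then have "\<forall>x\<in>carr X. norm (c * f x) \<le> (norm c * K) * nrm X x"
        by (simp add: norm_mult mult.assoc mult_left_mono)
      then have "\<exists>K. \<forall>x\<in>carr X. norm (c * f x) \<le> K * nrm X x" ..
      then show ?thesis
        using that by (simp add: dual_def bounded_functional_def algebra_simps)
    qed
  qed
  have zero: "f = 0" if f: "f \<in> carr (dual X)" and n: "nrm (dual X) f = 0" for f
  proof
    fix x
    show "f x = 0 x"
    proof (cases "x \<in> carr X \<and> x \<noteq> 0")
      case True
      then have pos: "0 < nrm X x"
        using X by (metis normed_space_def order_le_less)
      define c where "c = (of_real (inverse (nrm X x)) :: 'k)"
      have "smul X c x \<in> carr X" using True sub by (simp add: subspace_scale)
      moreover have "nrm X (smul X c x) = norm c * nrm X x"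
        using X True by (simp add: normed_space_def)
      then have "nrm X (smul X c x) = 1"
        using pos by (simp add: c_def norm_inverse)
      ultimately have "smul X c x \<in> closed_unit_ball X"
        by (simp add: closed_unit_ball_def)
      from dual_norm_upper(2)[OF X f this] n have "f (smul X c x) = 0" by simp
      moreover have "f (smul X c x) = c * f x"
        using f True by (simp add: dual_def bounded_functional_def)
      ultimately show ?thesis using pos by (simp add: c_def)
    next
      case False
      then consider "x \<notin> carr X" | "x = 0" by blast
      then show ?thesis
      proof cases
        case 1
        then show ?thesis using f by (simp add: dual_def)
      next
        case 2
        have "f (0 + 0) = f 0 + f 0"
          using f normed_space_0[OF X] unfolding dual_def bounded_functional_def by auto
        then show ?thesis using 2 by simp
      qed
    qed
  qed
  have nrm0: "nrm (dual X) 0 = 0"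
    using dual_norm_least[OF X, of 0 0] dual_norm_upper(3)[OF X D.subspace_0[OF subD]]
    by simp
  have scale_le: "nrm (dual X) (smul (dual X) c f) \<le> norm c * nrm (dual X) f"
    if "f \<in> carr (dual X)" for c f
    using dual_norm_upper(2)[OF X that]
    by (intro dual_norm_least[OF X]) (simp add: dual_def norm_mult mult_left_mono)
  have scale: "nrm (dual X) (smul (dual X) c f) = norm c * nrm (dual X) f"
    if f: "f \<in> carr (dual X)" for c f
  proof (cases "c = 0")
    case True
    then show ?thesis using nrm0 by (simp add: D.scale_zero_left)
  next
    case False
    have "nrm (dual X) (smul (dual X) (inverse c) (smul (dual X) c f))
        \<le> norm (inverse c) * nrm (dual X) (smul (dual X) c f)"
      by (intro scale_le D.subspace_scale[OF subD] f)
    moreover have "smul (dual X) (inverse c) (smul (dual X) c f) = f"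
      using False by simp
    ultimately have "norm c * nrm (dual X) f \<le> nrm (dual X) (smul (dual X) c f)"
      using False by (simp add: norm_inverse norm_divide field_simps)
    with scale_le[OF f] show ?thesis by (simp add: antisym)
  qed
  have "nrm (dual X) (f + g) \<le> nrm (dual X) f + nrm (dual X) g"
    if "f \<in> carr (dual X)" "g \<in> carr (dual X)" for f g
    using dual_norm_upper(2)[OF X that(1)] dual_norm_upper(2)[OF X that(2)]
    by (intro dual_norm_least[OF X])
       (auto intro: order_trans[OF norm_triangle_ineq] add_mono)
  with vs subD zero nrm0 scale dual_norm_upper(3)[OF X] show ?thesis
    unfolding normed_space_def by blast
qed

lemma normed_space_c0_sum:
  assumes X: "\<And>i. normed_space (X i)"
  shows "normed_space (c0_sum X)"
proof -
  have ax: "vector_space (smul (X i))" "module.subspace (smul (X i)) (carr (X i))"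
      "x \<in> carr (X i) \<Longrightarrow> 0 \<le> nrm (X i) x"
      "x \<in> carr (X i) \<Longrightarrow> nrm (X i) x = 0 \<longleftrightarrow> x = 0"
      "x \<in> carr (X i) \<Longrightarrow> nrm (X i) (smul (X i) c x) = norm c * nrm (X i) x"
      "x \<in> carr (X i) \<Longrightarrow> y \<in> carr (X i) \<Longrightarrow> nrm (X i) (x + y) \<le> nrm (X i) x + nrm (X i) y"
    for i c x y
    using X[of i] by (auto simp: normed_space_def)
  have m: "module (smul (X i))" for i using module_smul[OF X] .
  have vs: "vector_space (smul (c0_sum X))"
    using ax(1) unfolding vector_space_def c0_sum_def by (auto simp: fun_eq_iff)
  interpret S: vector_space "smul (c0_sum X)" by (rule vs)
  have sub: "S.subspace (carr (c0_sum X))"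
  proof (rule S.subspaceI)
    show "0 \<in> carr (c0_sum X)"
      using normed_space_0[OF X] by (simp add: c0_sum_def)
    show "x + y \<in> carr (c0_sum X)" if "x \<in> carr (c0_sum X)" "y \<in> carr (c0_sum X)" for x y
    proof -
      have c: "x i \<in> carr (X i)" "y i \<in> carr (X i)" "x i + y i \<in> carr (X i)" for i
        using that module.subspace_add[OF m ax(2)] by (auto simp: c0_sum_def)
      have "(\<lambda>i. nrm (X i) (x i) + nrm (X i) (y i)) \<longlonglongrightarrow> 0"
        using that by (auto simp: c0_sum_def intro: tendsto_add_zero)
      then have "(\<lambda>i. nrm (X i) (x i + y i)) \<longlonglongrightarrow> 0"
        by (rule tendsto_sandwich[OF _ _ tendsto_const, rotated 2])
           (auto intro!: always_eventually ax(3,6) c)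
      then show ?thesis using c by (simp add: c0_sum_def)
    qed
    show "smul (c0_sum X) c x \<in> carr (c0_sum X)" if "x \<in> carr (c0_sum X)" for c x
      using that module.subspace_scale[OF m ax(2)]
      by (auto simp: c0_sum_def ax(5) intro: tendsto_mult_right_zero)
  qed
  have bdd: "bdd_above (range (\<lambda>i. nrm (X i) (x i)))" if "x \<in> carr (c0_sum X)" for x
  proof -
    have "Bseq (\<lambda>i. nrm (X i) (x i))"
      using that by (auto simp: c0_sum_def intro!: convergent_imp_Bseq convergentI)
    then show ?thesis
      by (simp add: Bseq_eq_bounded bounded_imp_bdd_above)
  qed
  have up: "nrm (X i) (x i) \<le> nrm (c0_sum X) x" if "x \<in> carr (c0_sum X)" for x i
    using cSUP_upper[OF UNIV_I bdd[OF that]] by (simp add: c0_sum_def)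
  have least: "nrm (c0_sum X) x \<le> K" if "\<And>i. nrm (X i) (x i) \<le> K" for x K
    using that by (auto simp: c0_sum_def intro: cSUP_least)
  have c: "x i \<in> carr (X i)" if "x \<in> carr (c0_sum X)" for x i
    using that by (simp add: c0_sum_def)
  have nonneg: "0 \<le> nrm (c0_sum X) x" if "x \<in> carr (c0_sum X)" for x
    using up[OF that, of 0] ax(3)[OF c[OF that], of 0] by linarith
  have zero: "x = 0" if x: "x \<in> carr (c0_sum X)" and "nrm (c0_sum X) x = 0" for x
  proof
    fix i
    have "nrm (X i) (x i) = 0"
      using up[OF x, of i] ax(3)[OF c[OF x], of i] that(2) by linarith
    then show "x i = 0 i" using ax(4)[OF c[OF x]] by simp
  qed
  have nrm0: "nrm (c0_sum X) 0 = 0"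
    using normed_space_0[OF X] by (simp add: c0_sum_def)
  have scale_le: "nrm (c0_sum X) (smul (c0_sum X) a x) \<le> norm a * nrm (c0_sum X) x"
    if "x \<in> carr (c0_sum X)" for a x
  proof (rule least)
    fix i
    have "nrm (X i) (smul (c0_sum X) a x i) = norm a * nrm (X i) (x i)"
      using ax(5)[OF c[OF that]] by (simp add: c0_sum_def)
    then show "nrm (X i) (smul (c0_sum X) a x i) \<le> norm a * nrm (c0_sum X) x"
      using up[OF that] by (simp add: mult_left_mono)
  qed
  have scale: "nrm (c0_sum X) (smul (c0_sum X) a x) = norm a * nrm (c0_sum X) x"
    if x: "x \<in> carr (c0_sum X)" for a x
  proof (cases "a = 0")
    case True
    then show ?thesis using nrm0 by (simp add: S.scale_zero_left)
  next
    case False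
    have "nrm (c0_sum X) (smul (c0_sum X) (inverse a) (smul (c0_sum X) a x))
        \<le> norm (inverse a) * nrm (c0_sum X) (smul (c0_sum X) a x)"
      by (intro scale_le S.subspace_scale[OF sub] x)
    moreover have "smul (c0_sum X) (inverse a) (smul (c0_sum X) a x) = x"
      using False by simp
    ultimately have "norm a * nrm (c0_sum X) x \<le> nrm (c0_sum X) (smul (c0_sum X) a x)"
      using False by (simp add: norm_inverse norm_divide field_simps)
    with scale_le[OF x] show ?thesis by (simp add: antisym)
  qed
  have "nrm (c0_sum X) (x + y) \<le> nrm (c0_sum X) x + nrm (c0_sum X) y"
    if x: "x \<in> carr (c0_sum X)" and y: "y \<in> carr (c0_sum X)" for x y
  proof (rule least)
    fix i
    show "nrm (X i) ((x + y) i) \<le> nrm (c0_sum X) x + nrm (c0_sum X) y"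
      using ax(6)[OF c[OF x] c[OF y], of i] up[OF x, of i] up[OF y, of i] by simp
  qed
  with vs sub nonneg zero nrm0 scale show ?thesis
    unfolding normed_space_def by blast
qed

end

theory Submission
  imports Defs
begin

text \<open>
  The dual of the \<open>c\<^sub>0\<close>-sum is the \<open>\<ell>\<^sub>1\<close>-sum of the duals \<open>X\<^sub>i\<^sup>*\<close>. Fix dense sequences
  \<open>x\<^sub>i\<^sub>k\<close> in the \<open>X\<^sub>i\<close> and let \<open>K n\<close> be the space of functionals that vanish at the points \<open>x\<^sub>i\<^sub>k\<close>
  with \<open>i, k < n\<close>, placed in coordinate \<open>i\<close>. In the coset \<open>f + K n\<close> take the element \<open>\<phi> n f\<close> all of
  whose components have the least possible norm. It depends only on finitely many values of \<open>f\<close>, and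
  \<open>\<phi> n f\<close> converges to \<open>f\<close> in norm. Joining \<open>\<phi> n f\<close> to \<open>\<phi> (n + 1) f\<close> by segments gives a track from \<open>0\<close>
  to \<open>f\<close> along which the norm does not decrease. The retraction stops where the track leaves the unit ball.

  This works because of the form in which uniform convexity is used (\<open>additive_convexity\<close>): for every
  \<open>\<epsilon>\<close> there is a \<open>C\<close>, common to all \<open>i\<close>, with
  \<open>\<parallel>a - b\<parallel> \<le> \<epsilon> M + C (M - \<parallel>(a + b)/2\<parallel>)\<close> whenever \<open>\<parallel>a\<parallel>, \<parallel>b\<parallel> \<le> M\<close>. The inequality is homogeneous
  and linear in the norms, so it may be summed over the components although the \<open>\<ell>\<^sub>1\<close>-sum itself is
  far from uniformly convex. Two consequences carry the proof. If \<open>a\<close> comes before \<open>b\<close> on the track of \<open>f\<close>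
  and their norms are close, then \<open>a\<close> and \<open>b\<close> are close (\<open>track_close\<close>); hence any point of the track
  whose norm is near \<open>1\<close> is near the retract of \<open>f\<close> (\<open>near_sphere_imp_near_retr\<close>). And the part of the
  track inside the ball moves little when \<open>f\<close> is changed by a small functional and an element of
  \<open>K n\<close> (\<open>track_stable\<close>).

  Uniform continuity follows at once: if \<open>g\<close> is near \<open>f\<close>, the exit point of \<open>f\<close> is near a point
  of the track of \<open>g\<close>, whose norm is then near \<open>1\<close>. For weak-* continuity one more fact is needed,
  that a functional with small values at finitely many points agrees there with one of small norm
  (\<open>small_interpolation\<close>). A weak-* neighbour of \<open>f\<^sub>0\<close> is thus a norm neighbour modulo \<open>K n\<close>.
  If \<open>\<parallel>f\<^sub>0\<parallel> > 1\<close> the previous argument applies. If \<open>\<parallel>f\<^sub>0\<parallel> \<le> 1\<close>, choose \<open>n\<close> with \<open>\<phi> n f\<^sub>0\<close> near \<open>f\<^sub>0\<close>: either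
  the track of the neighbour \<open>f\<close> leaves the ball before \<open>\<phi> n f\<close>, and then it does so near
  \<open>\<phi> n f\<^sub>0\<close>, or the retract of \<open>f\<close> has the same values as \<open>f\<close> at the first points, which by density
  determine weak-* closeness on the unit ball (\<open>retr_stable\<close>).

  Minimal-norm extensions exist because a minimizing sequence is Cauchy (\<open>minimal_norm_extension\<close>).
  The whole argument is the same over the real and the complex field.
\<close>

section \<open>Normed spaces\<close>

text \<open>
  Pointwise real scaling makes the functionals elements of a real vector space, over the real and
  the complex field alike.
\<close>

instantiation "fun" :: (type, real_vector) real_vector
begin

definition scaleR_fun :: "real \<Rightarrow> ('a \<Rightarrow> 'b) \<Rightarrow> 'a \<Rightarrow> 'b" where
  "scaleR_fun c f = (\<lambda>x. c *\<^sub>R f x)"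

instance
  by standard (simp_all add: scaleR_fun_def fun_eq_iff algebra_simps)

end

lemma scaleR_fun_apply [simp]: "(c *\<^sub>R f) x = c *\<^sub>R f x" for f :: "'a \<Rightarrow> 'b::real_vector"
  by (simp add: scaleR_fun_def)

lemma
  assumes W: "normed_space W"
  shows ns_zero: "0 \<in> carr W" "nrm W 0 = 0"
    and ns_add: "x \<in> carr W \<Longrightarrow> y \<in> carr W \<Longrightarrow> x + y \<in> carr W"
    and ns_diff: "x \<in> carr W \<Longrightarrow> y \<in> carr W \<Longrightarrow> x - y \<in> carr W"
    and ns_smul: "x \<in> carr W \<Longrightarrow> smul W c x \<in> carr W"
    and ns_nonneg: "x \<in> carr W \<Longrightarrow> 0 \<le> nrm W x"
    and ns_eq_0: "x \<in> carr W \<Longrightarrow> nrm W x = 0 \<longleftrightarrow> x = 0"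
    and ns_nrm_smul: "x \<in> carr W \<Longrightarrow> nrm W (smul W c x) = norm c * nrm W x"
    and ns_triangle: "x \<in> carr W \<Longrightarrow> y \<in> carr W \<Longrightarrow> nrm W (x + y) \<le> nrm W x + nrm W y"
proof -
  interpret vector_space "smul W" using W by (simp add: normed_space_def)
  have sub: "subspace (carr W)" using W by (simp add: normed_space_def)
  show "0 \<in> carr W" "nrm W 0 = 0" using normed_space_0[OF W] by auto
  show "x \<in> carr W \<Longrightarrow> y \<in> carr W \<Longrightarrow> x + y \<in> carr W" by (rule subspace_add[OF sub])
  show "x \<in> carr W \<Longrightarrow> y \<in> carr W \<Longrightarrow> x - y \<in> carr W" by (rule subspace_diff[OF sub])
  show "x \<in> carr W \<Longrightarrow> smul W c x \<in> carr W" by (rule subspace_scale[OF sub])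
qed (use W in \<open>auto simp: normed_space_def\<close>)

lemma ns_triangle_diff:
  assumes W: "normed_space W" and "x \<in> carr W" "y \<in> carr W"
  shows "nrm W (x - y) \<le> nrm W x + nrm W y"
proof -
  interpret vector_space "smul W" using W by (simp add: normed_space_def)
  have "x - y = x + smul W (-1) y" by simp
  also have "nrm W \<dots> \<le> nrm W x + nrm W y"
    using ns_triangle[OF W assms(2) ns_smul[OF W assms(3)], of "-1"]
      ns_nrm_smul[OF W assms(3), of "-1"] by (simp del: scale_minus_left)
  finally show ?thesis .
qed

section \<open>Uniform convexity in additive form\<close>

text \<open>
  The defect \<open>s = M - \<parallel>(a + b)/2\<parallel>\<close> controls \<open>M - \<parallel>a\<parallel>\<close> and \<open>M - \<parallel>b\<parallel>\<close> by \<open>2 s\<close>, so \<open>a\<close> and \<open>b\<close> may be replaced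
  by multiples \<open>M u\<close> and \<open>M v\<close> of unit vectors. Either \<open>u\<close> and \<open>v\<close> are closer than \<open>\<epsilon>\<close>, or the modulus
  of convexity bounds \<open>M\<close> by a multiple of \<open>s\<close>, and then the trivial bound \<open>\<parallel>a - b\<parallel> \<le> 2 M\<close> suffices.
\<close>

lemma additive_convexity:
  fixes Z :: "'i \<Rightarrow> ('k::real_normed_field, 'z::ab_group_add) nspace"
  assumes Z: "\<And>i. normed_space (Z i)"
    and mod: "\<And>\<epsilon>. 0 < \<epsilon> \<Longrightarrow> \<epsilon> < 1 \<Longrightarrow> 0 < (INF i. modulus_of_convexity (Z i) \<epsilon>)"
    and e: "0 < e"
  shows "\<exists>C\<ge>0. \<forall>i M. \<forall>a\<in>carr (Z i). \<forall>b\<in>carr (Z i). nrm (Z i) a \<le> M \<longrightarrow> nrm (Z i) b \<le> M \<longrightarrow>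
    nrm (Z i) (a - b) \<le> e * M + C * (M - nrm (Z i) (smul (Z i) (1/2) (a + b)))"
proof -
  \<comment> \<open>The modulus is assumed positive only below \<open>1\<close>.\<close>
  define e' where "e' = min e (1/2)"
  have e': "0 < e'" "e' < 1" "e' \<le> e" using e by (auto simp: e'_def)
  obtain \<delta> where \<delta>: "0 < ereal \<delta>" "ereal \<delta> < (INF i. modulus_of_convexity (Z i) e')"
    using ereal_dense2[OF mod[OF e'(1,2)]] by auto
  then have "\<delta> > 0" by simp
  have uc: "nrm (Z i) (smul (Z i) (1/2) (x + y)) \<le> 1 - \<delta>"
    if "x \<in> unit_sphere (Z i)" "y \<in> unit_sphere (Z i)" "e' \<le> nrm (Z i) (x - y)" for i x y
  proof -
    have "ereal \<delta> \<le> modulus_of_convexity (Z i) e'"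
      using \<delta>(2) by (meson INF_lower UNIV_I less_imp_le order_trans)
    also have "\<dots> \<le> ereal (1 - nrm (Z i) (smul (Z i) (1/2) (x + y)))"
      unfolding modulus_of_convexity_def using that by (intro Inf_lower) blast
    finally show ?thesis by simp
  qed
  define C where "C = 8 + 6/\<delta>"
  have C: "C \<ge> 8" "6/\<delta> \<le> C" using \<open>\<delta> > 0\<close> by (auto simp: C_def)
  have "nrm (Z i) (a - b) \<le> e * M + C * (M - nrm (Z i) (smul (Z i) (1/2) (a + b)))"
    if a: "a \<in> carr (Z i)" and b: "b \<in> carr (Z i)" and aM: "nrm (Z i) a \<le> M"
      and bM: "nrm (Z i) b \<le> M" for i M a b
  proof -
    interpret vector_space "smul (Z i)" using Z by (simp add: normed_space_def)
    note [intro, simp] = ns_add[OF Z] ns_diff[OF Z] ns_smul[OF Z]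
    let ?n = "nrm (Z i)" and ?sm = "smul (Z i)"
    define s where "s = M - ?n (?sm (1/2) (a + b))"
    have s_mid: "?n (?sm (1/2) (a + b)) = M - s" by (simp add: s_def)
    have mid: "?n (?sm (1/2) (a + b)) \<le> (?n a + ?n b) / 2"
      using ns_nrm_smul[OF Z, of "a + b" i "1/2"] ns_triangle[OF Z a b] a b
      by (simp add: norm_divide)
    have s: "s \<ge> 0" "M - ?n a \<le> 2 * s" "M - ?n b \<le> 2 * s"
      using mid aM bM by (auto simp: s_def)
    have M: "M \<ge> 0" using ns_nonneg[OF Z a] aM by linarith
    have le2M: "?n (a - b) \<le> 2 * M" using ns_triangle_diff[OF Z a b] aM bM by linarith
    have Cs: "8 * s \<le> C * s" "6/\<delta> * s \<le> C * s"
      using C s(1) by (auto intro: mult_right_mono simp del: times_divide_eq_left)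
    have eM: "0 \<le> e * M" "e' * M \<le> e * M" using e' e M by (auto intro: mult_right_mono)
    have "?n (a - b) \<le> e * M + C * s"
    proof (cases "M \<le> 4 * s \<or> ?n a = 0 \<or> ?n b = 0")
      case True
      then have "M \<le> 4 * s" using s by auto
      then show ?thesis using le2M Cs eM by linarith
    next
      case False
      then have pos: "?n a > 0" "?n b > 0" "M > 0"
        using ns_nonneg[OF Z a] ns_nonneg[OF Z b] M s(1) by (auto simp: order_le_less)
      define u v where "u = ?sm (of_real (1 / ?n a)) a" and "v = ?sm (of_real (1 / ?n b)) b"
      have uv: "u \<in> unit_sphere (Z i)" "v \<in> unit_sphere (Z i)"
        using pos a b by (auto simp: u_def v_def unit_sphere_def ns_nrm_smul[OF Z] norm_divide)
      then have uv_in [simp]: "u \<in> carr (Z i)" "v \<in> carr (Z i)"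
        by (auto simp: unit_sphere_def)
      have far: "?n (a - ?sm (of_real M) u) \<le> 2 * s" "?n (b - ?sm (of_real M) v) \<le> 2 * s"
      proof -
        have *: "?n (c - ?sm (of_real M) (?sm (of_real (1 / ?n c)) c)) = M - ?n c"
          if c: "c \<in> carr (Z i)" "?n c > 0" "?n c \<le> M" for c
        proof -
          have "c - ?sm (of_real M) (?sm (of_real (1 / ?n c)) c) = ?sm (of_real (1 - M / ?n c)) c"
            by (simp add: scale_left_diff_distrib)
          then have "?n (c - ?sm (of_real M) (?sm (of_real (1 / ?n c)) c)) = \<bar>1 - M / ?n c\<bar> * ?n c"
            using ns_nrm_smul[OF Z c(1)] by (metis norm_of_real)
          also have "\<dots> = M - ?n c" using c by (simp add: abs_if field_simps)
          finally show ?thesis .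
        qed
        show "?n (a - ?sm (of_real M) u) \<le> 2 * s" "?n (b - ?sm (of_real M) v) \<le> 2 * s"
          using *[OF a pos(1) aM] *[OF b pos(2) bM] s by (auto simp: u_def v_def)
      qed
      show ?thesis
      proof (cases "e' \<le> ?n (u - v)")
        case True
        let ?m = "?sm (1/2) (u + v)" and ?p = "a - ?sm (of_real M) u" and ?q = "b - ?sm (of_real M) v"
        have "?sm (1/2) (a + b) = ?sm (of_real M) ?m + ?sm (1/2) (?p + ?q)"
          by (simp add: scale_right_distrib scale_right_diff_distrib mult.commute)
        then have "?n (?sm (1/2) (a + b)) \<le> ?n (?sm (of_real M) ?m) + ?n (?sm (1/2) (?p + ?q))"
          using ns_triangle[OF Z, of "?sm (of_real M) ?m" i "?sm (1/2) (?p + ?q)"] a b by auto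
        also have "\<dots> = M * ?n ?m + ?n (?p + ?q) / 2"
          using M a b by (simp add: ns_nrm_smul[OF Z] norm_divide)
        also have "\<dots> \<le> M * (1 - \<delta>) + (2 * s + 2 * s) / 2"
          using uc[OF uv True] M far ns_triangle[OF Z, of ?p i ?q] a b
          by (intro add_mono mult_left_mono) auto
        finally have "M - s \<le> M * (1 - \<delta>) + (2 * s + 2 * s) / 2"
          unfolding s_mid .
        then have "M * \<delta> \<le> 3 * s"
          unfolding right_diff_distrib by simp
        then have "2 * M \<le> 6/\<delta> * s" using \<open>\<delta> > 0\<close> by (simp add: field_simps)
        then show ?thesis using le2M Cs eM by linarith
      next
        case False
        let ?p = "a - ?sm (of_real M) u" and ?q = "b - ?sm (of_real M) v"
        have split: "a - b = ?sm (of_real M) (u - v) + (?p - ?q)"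
          by (simp add: scale_right_diff_distrib)
        have "?n (a - b) \<le> ?n (?sm (of_real M) (u - v)) + ?n (?p - ?q)"
          unfolding split by (rule ns_triangle[OF Z]) (use a b in auto)
        also have "\<dots> \<le> M * e' + (2 * s + 2 * s)"
          using False M far ns_triangle_diff[OF Z, of ?p i ?q] a b
          by (intro add_mono) (auto simp: ns_nrm_smul[OF Z] intro: mult_left_mono)
        finally show ?thesis using Cs eM s(1) by (simp add: mult.commute)
      qed
    qed
    then show ?thesis by (simp add: s_def)
  qed
  then show ?thesis using C by (intro exI[of _ C]) auto
qed

section \<open>Functionals of minimal norm\<close>

lemma
  assumes "f \<in> carr (dual W)"
  shows dual_add: "x \<in> carr W \<Longrightarrow> y \<in> carr W \<Longrightarrow> f (x + y) = f x + f y"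
    and dual_smul: "x \<in> carr W \<Longrightarrow> f (smul W c x) = c * f x"
    and dual_off: "x \<notin> carr W \<Longrightarrow> f x = 0"
  using assms by (auto simp: dual_def bounded_functional_def)

lemma dual_diff:
  assumes "normed_space W" "f \<in> carr (dual W)" "x \<in> carr W" "y \<in> carr W"
  shows "f (x - y) = f x - f y"
  using dual_add[OF assms(2) ns_diff[OF assms(1,3,4)] assms(4)] by simp

lemma dual_norm_apply:
  fixes W :: "('k::real_normed_field, 'v::ab_group_add) nspace"
  assumes W: "normed_space W" and f: "f \<in> carr (dual W)" and x: "x \<in> carr W"
  shows "norm (f x) \<le> nrm (dual W) f * nrm W x"
proof (cases "nrm W x = 0")
  case True
  then have "x = 0" using ns_eq_0[OF W x] by simp
  then show ?thesis
    using dual_diff[OF W f x x] True by simp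
next
  case False
  then have pos: "nrm W x > 0" using ns_nonneg[OF W x] by simp
  let ?c = "of_real (1 / nrm W x) :: 'k"
  have "smul W ?c x \<in> closed_unit_ball W"
    using ns_smul[OF W x] ns_nrm_smul[OF W x] pos by (simp add: closed_unit_ball_def norm_divide)
  from dual_norm_upper(2)[OF W f this] show ?thesis
    using pos by (simp add: dual_smul[OF f x] norm_mult norm_divide field_simps)
qed

lemma dualI:
  assumes "normed_space W"
    and "\<And>x y. x \<in> carr W \<Longrightarrow> y \<in> carr W \<Longrightarrow> f (x + y) = f x + f y"
    and "\<And>c x. x \<in> carr W \<Longrightarrow> f (smul W c x) = c * f x"
    and "\<And>x. x \<notin> carr W \<Longrightarrow> f x = 0"
    and K: "\<And>x. x \<in> carr W \<Longrightarrow> norm (f x) \<le> K * nrm W x" "0 \<le> K"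
  shows "f \<in> carr (dual W) \<and> nrm (dual W) f \<le> K"
proof
  have "\<exists>K. \<forall>x\<in>carr W. norm (f x) \<le> K * nrm W x" using K(1) by blast
  then show "f \<in> carr (dual W)"
    using assms(2-4) by (simp add: dual_def bounded_functional_def)
  show "nrm (dual W) f \<le> K"
  proof (rule dual_norm_least[OF assms(1)])
    fix x assume "x \<in> closed_unit_ball W"
    then have "norm (f x) \<le> K * nrm W x" "nrm W x \<le> 1"
      using K by (auto simp: closed_unit_ball_def)
    then show "norm (f x) \<le> K"
      using mult_left_mono[of "nrm W x" 1 K] K(2) by simp
  qed
qed

lemma smul_dual_of_real: "smul (dual W) (of_real c) f = c *\<^sub>R f"
  by (simp add: dual_def fun_eq_iff scaleR_conv_of_real)

lemma
  assumes W: "normed_space W"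
  shows subspace_dual: "subspace (carr (dual W))"
    and nrm_dual_scaleR: "f \<in> carr (dual W) \<Longrightarrow> nrm (dual W) (c *\<^sub>R f) = \<bar>c\<bar> * nrm (dual W) f"
proof -
  note D = normed_space_dual[OF W]
  show "subspace (carr (dual W))"
    unfolding subspace_def
    using ns_zero[OF D] ns_add[OF D] ns_smul[OF D, of _ "of_real _"]
    by (auto simp: smul_dual_of_real)
  show "f \<in> carr (dual W) \<Longrightarrow> nrm (dual W) (c *\<^sub>R f) = \<bar>c\<bar> * nrm (dual W) f"
    using ns_nrm_smul[OF D, of f "of_real c"] by (simp add: smul_dual_of_real)
qed

text \<open>
  A minimizing sequence in the coset is Cauchy: midpoints stay in the coset, so their norms do not
  drop below the infimum, and convexity applies. The pointwise limit attains the infimum.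
\<close>

lemma minimal_norm_extension:
  fixes W :: "('k::{real_normed_field,banach}, 'v::ab_group_add) nspace"
  assumes W: "normed_space W"
    and conv: "\<And>e. 0 < e \<Longrightarrow> \<exists>C\<ge>0. \<forall>M. \<forall>a\<in>carr (dual W). \<forall>b\<in>carr (dual W).
      nrm (dual W) a \<le> M \<longrightarrow> nrm (dual W) b \<le> M \<longrightarrow>
      nrm (dual W) (a - b) \<le> e * M + C * (M - nrm (dual W) ((1/2) *\<^sub>R (a + b)))"
    and f: "f \<in> carr (dual W)"
  shows "\<exists>a\<in>carr (dual W). (\<forall>y\<in>F. a y = f y) \<and>
    (\<forall>b\<in>carr (dual W). (\<forall>y\<in>F. b y = f y) \<longrightarrow> nrm (dual W) a \<le> nrm (dual W) b)"
proof -
  note D = normed_space_dual[OF W] and sub = subspace_dual[OF W]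
  let ?n = "nrm (dual W)"
  define S where "S = {a \<in> carr (dual W). \<forall>y\<in>F. a y = f y}"
  define m where "m = (INF a\<in>S. ?n a)"
  have S: "f \<in> S" "S \<subseteq> carr (dual W)" using f by (auto simp: S_def)
  have bdd: "bdd_below (?n ` S)"
    using ns_nonneg[OF D] S(2) by (intro bdd_belowI[of _ 0]) auto
  have m_le: "m \<le> ?n a" if "a \<in> S" for a
    unfolding m_def by (rule cINF_lower[OF bdd that])
  have m0: "0 \<le> m"
    unfolding m_def using S ns_nonneg[OF D] by (intro cINF_greatest) auto
  have "\<exists>a\<in>S. ?n a < m + 1 / Suc k" for k
    using cInf_lessD[of "?n ` S" "m + 1 / Suc k"] S(1) unfolding m_def by auto
  then obtain a where a: "\<And>k. a k \<in> S" "\<And>k. ?n (a k) < m + 1 / Suc k" by metis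
  have aD: "a k \<in> carr (dual W)" for k using a(1) S(2) by blast
  have Cauchy_norm: "\<exists>k0. \<forall>k\<ge>k0. \<forall>l\<ge>k0. ?n (a k - a l) \<le> e" if e: "0 < e" for e
  proof -
    define e' where "e' = e / (2 * (m + 1))"
    have e': "e' > 0" "e' * (m + 1) = e/2" using e m0 by (auto simp: e'_def field_simps)
    obtain C where C: "C \<ge> 0" and close: "\<And>M a b. a \<in> carr (dual W) \<Longrightarrow> b \<in> carr (dual W) \<Longrightarrow>
      ?n a \<le> M \<Longrightarrow> ?n b \<le> M \<Longrightarrow> ?n (a - b) \<le> e' * M + C * (M - ?n ((1/2) *\<^sub>R (a + b)))"
      using conv[OF e'(1)] by metis
    obtain k0 where k0: "1 / Suc k0 < e / (2 * (C + 1))"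
      using nat_approx_posE[of "e / (2 * (C + 1))"] e C by auto
    have "?n (a k - a l) \<le> e" if kl: "k \<ge> k0" "l \<ge> k0" for k l
    proof -
      have mono: "1 / Suc j \<le> 1 / Suc k0" if "j \<ge> k0" for j
        using that by (simp add: frac_le)
      have "(1/2) *\<^sub>R (a k + a l) \<in> S"
      proof -
        have "(1/2) *\<^sub>R (f y + f y) = f y" for y
          by (metis scaleR_half_double)
        then have "\<forall>y\<in>F. ((1/2) *\<^sub>R (a k + a l)) y = f y"
          using a(1)[of k] a(1)[of l] by (simp add: S_def)
        then show ?thesis
          using subspace_scale[OF sub subspace_add[OF sub aD aD]] by (simp add: S_def)
      qed
      then have mid: "m \<le> ?n ((1/2) *\<^sub>R (a k + a l))" by (rule m_le)
      have "?n (a k - a l) \<le> e' * (m + 1 / Suc k0)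
          + C * (m + 1 / Suc k0 - ?n ((1/2) *\<^sub>R (a k + a l)))"
        using a(2)[of k] a(2)[of l] mono kl by (intro close aD) fastforce+
      also have "\<dots> \<le> e' * (m + 1) + C * (e / (2 * (C + 1)))"
        using e' C mid k0 by (intro add_mono mult_left_mono) auto
      also have "C * (e / (2 * (C + 1))) \<le> e/2" using C e by (simp add: field_simps)
      finally show ?thesis using e'(2) by linarith
    qed
    then show ?thesis by blast
  qed
  have "\<exists>L. (\<lambda>k. a k x) \<longlonglongrightarrow> L" for x
  proof (cases "x \<in> carr W")
    case True
    have "Cauchy (\<lambda>k. a k x)"
    proof (rule metric_CauchyI)
      fix e :: real assume "0 < e"
      define e' where "e' = e / (2 * (nrm W x + 1))"
      have "e' > 0" using \<open>0 < e\<close> ns_nonneg[OF W True] by (simp add: e'_def)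
      then obtain k0 where k0: "\<And>k l. k \<ge> k0 \<Longrightarrow> l \<ge> k0 \<Longrightarrow> ?n (a k - a l) \<le> e'"
        using Cauchy_norm by blast
      have "dist (a k x) (a l x) < e" if "k \<ge> k0" "l \<ge> k0" for k l
      proof -
        have "dist (a k x) (a l x) \<le> ?n (a k - a l) * nrm W x"
          using dual_norm_apply[OF W ns_diff[OF D aD aD] True] by (simp add: dist_norm)
        also have "\<dots> \<le> e' * (nrm W x + 1)"
          using k0[OF that] ns_nonneg[OF W True] \<open>e' > 0\<close> by (intro mult_mono) auto
        also have "\<dots> < e"
          using \<open>0 < e\<close> ns_nonneg[OF W True] by (simp add: e'_def field_simps add_pos_nonneg)
        finally show ?thesis .
      qed
      then show "\<exists>M. \<forall>m\<ge>M. \<forall>n\<ge>M. dist (a m x) (a n x) < e" by blast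
    qed
    then show ?thesis by (simp add: Cauchy_convergent_iff convergent_def)
  next
    case False
    then show ?thesis using dual_off[OF aD] by (auto intro: exI[of _ 0])
  qed
  then obtain L where L: "\<And>x. (\<lambda>k. a k x) \<longlonglongrightarrow> L x" by metis
  have LI: "L \<in> carr (dual W) \<and> ?n L \<le> m"
  proof (rule dualI[OF W])
    fix x y assume xy: "x \<in> carr W" "y \<in> carr W"
    have "(\<lambda>k. a k (x + y)) \<longlonglongrightarrow> L x + L y"
      using tendsto_add[OF L[of x] L[of y]] by (simp add: dual_add[OF aD xy])
    then show "L (x + y) = L x + L y" using L LIMSEQ_unique by blast
  next
    fix c x assume x: "x \<in> carr W"
    have "(\<lambda>k. a k (smul W c x)) \<longlonglongrightarrow> c * L x"
      using tendsto_mult_left[OF L[of x]] by (simp add: dual_smul[OF aD x])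
    then show "L (smul W c x) = c * L x" using L LIMSEQ_unique by blast
  next
    fix x assume "x \<notin> carr W"
    then show "L x = 0" using L[of x] dual_off[OF aD] by (simp add: LIMSEQ_const_iff)
  next
    fix x assume x: "x \<in> carr W"
    have lim: "(\<lambda>k. (m + 1 / Suc k) * nrm W x) \<longlonglongrightarrow> (m + 0) * nrm W x"
      by (rule tendsto_mult_right[OF tendsto_add[OF tendsto_const
            LIMSEQ_inverse_real_of_nat[unfolded inverse_eq_divide]]])
    have "norm (a k x) \<le> (m + 1 / Suc k) * nrm W x" for k
      using dual_norm_apply[OF W aD x, of k] a(2)[of k] ns_nonneg[OF W x]
      by (smt (verit) mult_right_mono)
    then show "norm (L x) \<le> m * nrm W x"
      using LIMSEQ_le[OF tendsto_norm[OF L[of x]] lim] by auto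
  qed (rule m0)
  have "L y = f y" if "y \<in> F" for y
    using L[of y] a(1) that by (simp add: S_def LIMSEQ_const_iff)
  then show ?thesis
    using LI m_le by (intro bexI[of _ L]) (force simp: S_def)+
qed

section \<open>The weak-* topology and separability\<close>

text \<open>
  Induction on \<open>F\<close>. Either the value at the new point \<open>x\<close> is determined by the values on \<open>F\<close>, or some
  \<open>h\<close> vanishes on \<open>F\<close> with \<open>h x = 1\<close>, and a small multiple of \<open>h\<close> corrects the value at \<open>x\<close>.
  With \<open>F\<close> finite this makes weak-* neighbours into norm neighbours modulo the annihilator of \<open>F\<close>.
\<close>

lemma small_interpolation:
  fixes W :: "('k::real_normed_field, 'v::ab_group_add) nspace"
  assumes W: "normed_space W" and "finite F" "F \<subseteq> carr W" "0 < e"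
  shows "\<exists>d>0. \<forall>f\<in>carr (dual W). (\<forall>y\<in>F. norm (f y) < d) \<longrightarrow>
    (\<exists>g\<in>carr (dual W). nrm (dual W) g \<le> e \<and> (\<forall>y\<in>F. g y = f y))"
  using assms(2-4)
proof (induction F arbitrary: e rule: finite_induct)
  case empty
  note D = normed_space_dual[OF W]
  show ?case
    using ns_zero[OF D] empty by (intro exI[of _ 1]) (auto intro!: bexI[of _ 0])
next
  case (insert x F)
  note D = normed_space_dual[OF W]
  have x: "x \<in> carr W" and F: "F \<subseteq> carr W" using insert.prems by auto
  show ?case
  proof (cases "\<forall>h\<in>carr (dual W). (\<forall>y\<in>F. h y = 0) \<longrightarrow> h x = 0")
    case True
    obtain d where d: "d > 0" "\<And>f. f \<in> carr (dual W) \<Longrightarrow> (\<forall>y\<in>F. norm (f y) < d) \<Longrightarrow>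
        \<exists>g\<in>carr (dual W). nrm (dual W) g \<le> e \<and> (\<forall>y\<in>F. g y = f y)"
      using insert.IH[OF F insert.prems(2)] by blast
    have "\<exists>g\<in>carr (dual W). nrm (dual W) g \<le> e \<and> (\<forall>y\<in>insert x F. g y = f y)"
      if f: "f \<in> carr (dual W)" and small: "\<forall>y\<in>insert x F. norm (f y) < d" for f
    proof -
      obtain g where g: "g \<in> carr (dual W)" "nrm (dual W) g \<le> e" "\<forall>y\<in>F. g y = f y"
        using d(2)[OF f] small by blast
      have "(g - f) x = 0"
        using True[rule_format, OF ns_diff[OF D g(1) f]] g(3) by simp
      then show ?thesis using g by auto
    qed
    then show ?thesis using d(1) by blast
  next
    case False
    then obtain h0 where h0: "h0 \<in> carr (dual W)" "\<forall>y\<in>F. h0 y = 0" "h0 x \<noteq> 0" by blast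
    define h where "h = smul (dual W) (1 / h0 x) h0"
    have h_apply: "h y = 1 / h0 x * h0 y" for y by (simp add: h_def dual_def)
    have h: "h \<in> carr (dual W)" "\<forall>y\<in>F. h y = 0" "h x = 1"
      using h0(2,3) by (simp_all add: h_apply) (simp add: h_def ns_smul[OF D h0(1)])
    define c where "c = nrm (dual W) h"
    have c: "c \<ge> 0" using ns_nonneg[OF D h(1)] by (simp add: c_def)
    define p where "p = 1 + nrm W x * c"
    define e' where "e' = e / (2 * p)"
    have "p > 0" using ns_nonneg[OF W x] c by (simp add: p_def add_pos_nonneg)
    then have e': "e' > 0" "e' * p = e/2"
      using insert.prems(2) by (auto simp: e'_def)
    obtain d where d: "d > 0" "\<And>f. f \<in> carr (dual W) \<Longrightarrow> (\<forall>y\<in>F. norm (f y) < d) \<Longrightarrow>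
        \<exists>g\<in>carr (dual W). nrm (dual W) g \<le> e' \<and> (\<forall>y\<in>F. g y = f y)"
      using insert.IH[OF F e'(1)] by blast
    define d' where "d' = min d (e / (2 * (c + 1)))"
    have d': "d' > 0" "d' \<le> d" "d' * c \<le> e/2"
    proof -
      have "d' * c \<le> e / (2 * (c + 1)) * (c + 1)"
        unfolding d'_def using c insert.prems(2) by (intro mult_mono) auto
      also have "\<dots> = e/2" using c by (simp add: field_simps)
      finally show "d' * c \<le> e/2" .
    qed (use d c insert.prems(2) in \<open>auto simp: d'_def\<close>)
    have "\<exists>g\<in>carr (dual W). nrm (dual W) g \<le> e \<and> (\<forall>y\<in>insert x F. g y = f y)"
      if f: "f \<in> carr (dual W)" and small: "\<forall>y\<in>insert x F. norm (f y) < d'" for f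
    proof -
      obtain g where g: "g \<in> carr (dual W)" "nrm (dual W) g \<le> e'" "\<forall>y\<in>F. g y = f y"
        using d(2)[OF f] small d'(2) by fastforce
      define k where "k = smul (dual W) (f x - g x) h"
      have k_apply: "k y = (f x - g x) * h y" for y by (simp add: k_def dual_def)
      have k: "k \<in> carr (dual W)" "nrm (dual W) k = norm (f x - g x) * c"
        unfolding k_def c_def by (rule ns_smul[OF D h(1)], rule ns_nrm_smul[OF D h(1)])
      have k_values: "\<forall>y\<in>F. k y = 0" "k x = f x - g x"
        using h(2,3) by (simp_all add: k_apply)
      have "norm (f x - g x) \<le> d' + e' * nrm W x"
        using norm_triangle_ineq4[of "f x" "g x"] small dual_norm_apply[OF W g(1) x]
          mult_right_mono[OF g(2) ns_nonneg[OF W x]] by fastforce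
      then have "nrm (dual W) k \<le> (d' + e' * nrm W x) * c"
        using k(2) c by (simp add: mult_right_mono)
      then have "nrm (dual W) (g + k) \<le> e' + (d' + e' * nrm W x) * c"
        using ns_triangle[OF D g(1) k(1)] g(2) by linarith
      also have "\<dots> = e' * p + d' * c" by (simp add: p_def algebra_simps)
      also have "\<dots> \<le> e" using e' d' by linarith
      finally show ?thesis
        using ns_add[OF D g(1) k(1)] g(3) k_values by (intro bexI[of _ "g + k"]) auto
    qed
    then show ?thesis using d'(1) by blast
  qed
qed

lemma continuous_map_weak_starI:
  fixes W :: "('k::real_normed_field, 'v::ab_group_add) nspace"
  assumes W: "normed_space W" and r: "r \<in> carr (dual W) \<rightarrow> carr (dual W)"
    and cont: "\<And>f0 x e. f0 \<in> carr (dual W) \<Longrightarrow> x \<in> carr W \<Longrightarrow> 0 < e \<Longrightarrow>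
      \<exists>F d. finite F \<and> F \<subseteq> carr W \<and> 0 < d \<and>
        (\<forall>f\<in>carr (dual W). (\<forall>y\<in>F. norm (f y - f0 y) < d) \<longrightarrow> norm (r f x - r f0 x) < e)"
  shows "continuous_map (weak_star W) (weak_star W) r"
proof -
  let ?D = "carr (dual W)"
  define B where "B = {{f \<in> ?D. f x \<in> U} | x U. x \<in> carr W \<and> open U}"
  have ws: "weak_star W = topology_generated_by B" by (simp add: weak_star_def B_def)
  have top: "topspace (weak_star W) = ?D" by (rule topspace_weak_star[OF W])
  have basis: "openin (weak_star W) {f \<in> ?D. f x \<in> U}" if "x \<in> carr W" "open U" for x U
    unfolding ws by (rule topology_generated_by_Basis) (use that in \<open>auto simp: B_def\<close>)
  have "continuous_map (weak_star W) (topology_generated_by B) r"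
  proof (rule continuous_on_generated_topo)
    show "r ` topspace (weak_star W) \<subseteq> \<Union> B"
      using r top unfolding ws topology_generated_by_topspace by blast
    fix V assume "V \<in> B"
    then obtain x U where x: "x \<in> carr W" and U: "open U" and V: "V = {f \<in> ?D. f x \<in> U}"
      by (auto simp: B_def)
    show "openin (weak_star W) (r -` V \<inter> topspace (weak_star W))"
    proof (subst openin_subopen, intro ballI)
      fix f0 assume "f0 \<in> r -` V \<inter> topspace (weak_star W)"
      then have f0: "f0 \<in> ?D" "r f0 x \<in> U" by (auto simp: V top)
      then obtain e where e: "e > 0" "\<And>z. dist z (r f0 x) < e \<Longrightarrow> z \<in> U"
        using U unfolding open_dist by blast
      from cont[OF f0(1) x e(1)] obtain F d
        where F: "finite F" "F \<subseteq> carr W" and d: "d > 0" and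
          close: "\<forall>f\<in>?D. (\<forall>y\<in>F. norm (f y - f0 y) < d) \<longrightarrow> norm (r f x - r f0 x) < e"
        by (elim exE conjE)
      let ?N = "(\<Inter>y\<in>F. {f \<in> ?D. f y \<in> ball (f0 y) d}) \<inter> topspace (weak_star W)"
      have "openin (weak_star W) ?N"
        using F by (intro openin_INT basis) auto
      moreover have "f0 \<in> ?N" using f0(1) top d by auto
      moreover have "?N \<subseteq> r -` V \<inter> topspace (weak_star W)"
      proof
        fix f assume f: "f \<in> ?N"
        then have fD: "f \<in> ?D" using top by blast
        have "norm (r f x - r f0 x) < e"
        proof (rule close[rule_format, OF fD])
          fix y assume "y \<in> F"
          then show "norm (f y - f0 y) < d"
            using f by (auto simp: dist_norm norm_minus_commute)
        qed
        then have "r f x \<in> U" by (intro e(2)) (simp add: dist_norm)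
        then show "f \<in> r -` V \<inter> topspace (weak_star W)"
          using fD r by (auto simp: V top)
      qed
      ultimately show "\<exists>T. openin (weak_star W) T \<and> f0 \<in> T \<and> T \<subseteq> r -` V \<inter> topspace (weak_star W)"
        by blast
    qed
  qed
  then show ?thesis by (simp add: ws)
qed

lemma dense_sequence:
  assumes W: "normed_space W" and sep: "separable_nspace W"
  shows "\<exists>x. (\<forall>k::nat. x k \<in> carr W) \<and> (\<forall>v\<in>carr W. \<forall>e>0. \<exists>k. nrm W (v - x k) < e)"
proof -
  interpret Metric_space "carr W" "ndist W" by (rule Metric_space_ndist[OF W])
  obtain U where U: "countable U" "U \<subseteq> carr W" "mtopology closure_of U = carr W"
    using sep unfolding separable_nspace_def norm_metric_def separable_space_def by auto
  have dense: "\<exists>y\<in>U. nrm W (v - y) < e" if v: "v \<in> carr W" and "0 < e" for v e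
  proof -
    have "v \<in> mtopology closure_of U" using U(3) v by simp
    then obtain y where "y \<in> U" "y \<in> mball v e"
      using \<open>0 < e\<close> by (auto simp: metric_closure_of)
    then show ?thesis by (auto simp: in_mball ndist_def)
  qed
  have "U \<noteq> {}" using dense[OF ns_zero(1)[OF W], of 1] by auto
  then have "range (from_nat_into U) = U" using U(1) by (rule range_from_nat_into)
  then have "\<exists>k. y = from_nat_into U k" if "y \<in> U" for y
    using that by blast
  then have "\<exists>k. nrm W (v - from_nat_into U k) < e" if "v \<in> carr W" "0 < e" for v e
    using dense[OF that] by blast
  moreover have "from_nat_into U k \<in> carr W" for k
    using from_nat_into[OF \<open>U \<noteq> {}\<close>] U(2) by blast
  ultimately show ?thesis by blast
qed

section \<open>A retraction built from componentwise minimal projections\<close>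

text \<open>
  The \<open>\<ell>\<^sub>1\<close>-sum as seen from the retraction: \<open>N i\<close> is the norm of the \<open>i\<close>-th component and \<open>nn\<close> the sum of
  these. The rule \<open>exhaustion\<close> is what remains of weak-* lower semicontinuity of the norm and of the
  density of the union of the spaces on which \<open>\<phi> n f\<close> and \<open>f\<close> agree.
\<close>

locale l1_convex_projections =
  fixes D :: "'z::real_vector set"
    and N :: "nat \<Rightarrow> 'z \<Rightarrow> real"
    and nn :: "'z \<Rightarrow> real"
    and K :: "nat \<Rightarrow> 'z set"
    and \<phi> :: "nat \<Rightarrow> 'z \<Rightarrow> 'z"
  assumes D: "subspace D"
    and N_nonneg: "f \<in> D \<Longrightarrow> 0 \<le> N i f"
    and N_scale: "f \<in> D \<Longrightarrow> N i (c *\<^sub>R f) = \<bar>c\<bar> * N i f"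
    and N_triangle: "f \<in> D \<Longrightarrow> g \<in> D \<Longrightarrow> N i (f + g) \<le> N i f + N i g"
    and nn_sums: "f \<in> D \<Longrightarrow> (\<lambda>i. N i f) sums nn f"
    and convexity: "0 < e \<Longrightarrow> \<exists>C\<ge>0. \<forall>i M. \<forall>f\<in>D. \<forall>g\<in>D. N i f \<le> M \<longrightarrow> N i g \<le> M \<longrightarrow>
        N i (f - g) \<le> e * M + C * (M - N i ((1/2) *\<^sub>R (f + g)))"
    and K: "subspace (K n)" "K n \<subseteq> D" "K (Suc n) \<subseteq> K n" "K 0 = D"
    and \<phi>_in: "f \<in> D \<Longrightarrow> \<phi> n f \<in> D"
    and \<phi>_coset: "f \<in> D \<Longrightarrow> f - \<phi> n f \<in> K n"
    and \<phi>_min: "f \<in> D \<Longrightarrow> h \<in> K n \<Longrightarrow> N i (\<phi> n f) \<le> N i (\<phi> n f + h)"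
    and exhaustion: "f \<in> D \<Longrightarrow> (\<And>n. nn (\<phi> n f) \<le> c) \<Longrightarrow> nn f \<le> c"
begin

lemmas D_closed [intro, simp] =
  subspace_add[OF D] subspace_diff[OF D] subspace_scale[OF D] subspace_neg[OF D] subspace_0[OF D]
lemmas K_closed = subspace_add[OF K(1)] subspace_diff[OF K(1)] subspace_scale[OF K(1)]
  subspace_neg[OF K(1)] subspace_0[OF K(1)]
lemmas [simp] = \<phi>_in

lemma K_antimono: "m \<le> n \<Longrightarrow> K n \<subseteq> K m"
  using K(3) by (rule lift_Suc_antimono_le)

lemma N_zero [simp]: "N i 0 = 0"
  using N_scale[of 0 i 0] by simp

lemma N_minus: "f \<in> D \<Longrightarrow> N i (- f) = N i f"
  using N_scale[of f i "-1"] by simp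

lemma nn_le_if_N_le:
  assumes "f \<in> D" "g \<in> D" "\<And>i. N i f \<le> N i g"
  shows "nn f \<le> nn g"
  using sums_le[OF _ nn_sums nn_sums] assms by blast

lemma nn_nonneg: "f \<in> D \<Longrightarrow> 0 \<le> nn f"
  using sums_le[OF _ sums_zero nn_sums] N_nonneg by blast

lemma nn_scale: "f \<in> D \<Longrightarrow> nn (c *\<^sub>R f) = \<bar>c\<bar> * nn f"
  using sums_unique2[OF nn_sums[of "c *\<^sub>R f"] ] sums_mult[OF nn_sums[of f], of "\<bar>c\<bar>"]
  by (simp add: N_scale)

lemma nn_triangle: "f \<in> D \<Longrightarrow> g \<in> D \<Longrightarrow> nn (f + g) \<le> nn f + nn g"
  by (rule sums_le[OF _ nn_sums sums_add[OF nn_sums nn_sums]]) (auto intro: N_triangle)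

lemma nn_zero [simp]: "nn 0 = 0"
  using nn_scale[of 0 0] by simp

lemma nn_minus: "f \<in> D \<Longrightarrow> g \<in> D \<Longrightarrow> nn (f - g) = nn (g - f)"
  using nn_scale[of "f - g" "-1"] by simp

lemma nn_diff_triangle: "f \<in> D \<Longrightarrow> g \<in> D \<Longrightarrow> h \<in> D \<Longrightarrow> nn (f - h) \<le> nn (f - g) + nn (g - h)"
  using nn_triangle[of "f - g" "g - h"] by simp

lemma nn_diff_le: "f \<in> D \<Longrightarrow> g \<in> D \<Longrightarrow> \<bar>nn f - nn g\<bar> \<le> nn (f - g)"
  using nn_triangle[of "f - g" g] nn_triangle[of "g - f" f] nn_minus[of f g] by simp

text \<open>
  In a Hilbert space this holds when the angle at \<open>a\<close> between the segments to \<open>0\<close> and to \<open>b\<close> is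
  not acute. It is what remains of minimality when convexity is applied to the midpoint
  of \<open>a\<close> and \<open>b\<close>, and it holds both for \<open>a = \<phi> n f\<close> with \<open>b\<close> in its coset and for successive points
  of one segment of the track.
\<close>

definition obtuse :: "'z \<Rightarrow> 'z \<Rightarrow> bool" where
  "obtuse a b \<longleftrightarrow> a \<in> D \<and> b \<in> D \<and>
     (\<forall>i. N i a \<le> N i b \<and> N i a \<le> N i ((1/2) *\<^sub>R (a + b)))"

lemma obtuse_nn_le: "obtuse a b \<Longrightarrow> nn a \<le> nn b"
  unfolding obtuse_def using nn_le_if_N_le by blast

text \<open>
  Convexity of the components with \<open>M = N i b\<close>, summed over \<open>i\<close>.
\<close>

lemma obtuse_close:
  assumes "0 < e"
  shows "\<exists>C\<ge>0. \<forall>a b. obtuse a b \<longrightarrow> nn (a - b) \<le> e * nn b + C * (nn b - nn a)"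
proof -
  obtain C where C: "C \<ge> 0" and conv: "\<And>i M f g. f \<in> D \<Longrightarrow> g \<in> D \<Longrightarrow> N i f \<le> M \<Longrightarrow> N i g \<le> M \<Longrightarrow>
        N i (f - g) \<le> e * M + C * (M - N i ((1/2) *\<^sub>R (f + g)))"
    using convexity[OF assms] by metis
  have "nn (a - b) \<le> e * nn b + C * (nn b - nn a)" if ab: "obtuse a b" for a b
  proof (rule sums_le)
    show "(\<lambda>i. N i (a - b)) sums nn (a - b)"
      using ab by (intro nn_sums) (auto simp: obtuse_def)
    show "(\<lambda>i. e * N i b + C * (N i b - N i a)) sums (e * nn b + C * (nn b - nn a))"
      using ab by (intro sums_add sums_mult sums_diff nn_sums) (auto simp: obtuse_def)
    fix i
    have "N i (a - b) \<le> e * N i b + C * (N i b - N i ((1/2) *\<^sub>R (a + b)))"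
      using ab by (intro conv) (auto simp: obtuse_def)
    also have "\<dots> \<le> e * N i b + C * (N i b - N i a)"
      using ab C by (intro add_left_mono mult_left_mono) (auto simp: obtuse_def)
    finally show "N i (a - b) \<le> e * N i b + C * (N i b - N i a)" .
  qed
  then show ?thesis using C by blast
qed

lemma obtuse_projection:
  assumes f: "f \<in> D" and b: "b \<in> D" "f - b \<in> K n"
  shows "obtuse (\<phi> n f) b"
proof -
  have h: "b - \<phi> n f \<in> K n"
    using K_closed(2)[OF \<phi>_coset[OF f] b(2)] by simp
  have "N i (\<phi> n f) \<le> N i b" for i
    using \<phi>_min[OF f h] by simp
  moreover have "N i (\<phi> n f) \<le> N i ((1/2) *\<^sub>R (\<phi> n f + b))" for i
  proof -
    have "\<phi> n f + (1/2) *\<^sub>R (b - \<phi> n f) = (1/2) *\<^sub>R (\<phi> n f + b)"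
      by (simp add: algebra_simps flip: scaleR_2)
    then show ?thesis
      using \<phi>_min[OF f K_closed(3)[OF h, of "1/2"], of i] by simp
  qed
  ultimately show ?thesis
    using assms by (simp add: obtuse_def)
qed

lemma nn_projection_le: "f \<in> D \<Longrightarrow> nn (\<phi> n f) \<le> nn f"
  by (intro obtuse_nn_le obtuse_projection) (auto intro: K_closed)

text \<open>
  The projections of \<open>f\<close> and \<open>g\<close> lie, up to \<open>h\<close>, in the same coset. So each is almost minimal there
  in comparison with the other and with their midpoint; the three errors are multiples of \<open>N i h\<close>,
  and convexity with \<open>M = N i (\<phi> n f) + N i h\<close> gives the bound. Its right-hand side is homogeneous of degree
  one, so it survives multiplication by the coefficients of a convex combination.
\<close>

lemma projection_stable:
  assumes "0 < e"
  shows "\<exists>C\<ge>0. \<forall>n. \<forall>f\<in>D. \<forall>g\<in>D. \<forall>h\<in>D. f - g - h \<in> K n \<longrightarrow>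
    nn (\<phi> n f - \<phi> n g) \<le> e * (nn (\<phi> n f) + nn h) + C * nn h"
proof -
  obtain C where C: "C \<ge> 0" and conv: "\<And>i M f g. f \<in> D \<Longrightarrow> g \<in> D \<Longrightarrow> N i f \<le> M \<Longrightarrow> N i g \<le> M \<Longrightarrow>
        N i (f - g) \<le> e * M + C * (M - N i ((1/2) *\<^sub>R (f + g)))"
    using convexity[OF assms] by metis
  have "nn (\<phi> n f - \<phi> n g) \<le> e * (nn (\<phi> n f) + nn h) + 2 * C * nn h"
    if f: "f \<in> D" and g: "g \<in> D" and h: "h \<in> D" and k: "f - g - h \<in> K n" for n f g h
  proof (rule sums_le)
    let ?a = "\<phi> n f" and ?b = "\<phi> n g"
    show "(\<lambda>i. N i (?a - ?b)) sums nn (?a - ?b)"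
      using f g by (intro nn_sums) auto
    show "(\<lambda>i. e * (N i ?a + N i h) + 2 * C * N i h) sums (e * (nn ?a + nn h) + 2 * C * nn h)"
      using f g h by (intro sums_add sums_mult nn_sums) auto
    fix i
    have *: "?a - h - ?b \<in> K n"
    proof -
      have "(f - g - h) - (f - ?a) + (g - ?b) \<in> K n"
        by (rule K_closed(1)[OF K_closed(2)[OF k \<phi>_coset[OF f]] \<phi>_coset[OF g]])
      then show ?thesis by (simp add: algebra_simps)
    qed
    have Na: "N i ?a \<le> N i ?a + N i h"
      using h N_nonneg by auto
    have "N i ?b \<le> N i (?a + - h)"
      using \<phi>_min[OF g *, of i] by simp
    also have "\<dots> \<le> N i ?a + N i h"
      using N_triangle[of ?a "-h" i] f h by (simp add: N_minus)
    finally have Nb: "N i ?b \<le> N i ?a + N i h" .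
    have "N i ?a \<le> N i (?a + (-1/2) *\<^sub>R (?a - h - ?b))"
      by (rule \<phi>_min[OF f K_closed(3)[OF *]])
    also have "?a + (-1/2) *\<^sub>R (?a - h - ?b) = (1/2) *\<^sub>R (?a + ?b) + (1/2) *\<^sub>R h"
    proof -
      have "?a = (1/2) *\<^sub>R ?a + (1/2) *\<^sub>R ?a" by (simp flip: scaleR_add_left)
      then show ?thesis by (simp add: algebra_simps)
    qed
    also have "N i \<dots> \<le> N i ((1/2) *\<^sub>R (?a + ?b)) + N i ((1/2) *\<^sub>R h)"
      using f g h by (intro N_triangle) auto
    finally have mid: "N i ?a + N i h - N i ((1/2) *\<^sub>R (?a + ?b)) \<le> 2 * N i h"
      using N_nonneg[OF h, of i] N_scale[OF h, of i "1/2"] by simp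
    have "N i (?a - ?b) \<le> e * (N i ?a + N i h)
        + C * (N i ?a + N i h - N i ((1/2) *\<^sub>R (?a + ?b)))"
      using f g Na Nb by (intro conv) auto
    also have "\<dots> \<le> e * (N i ?a + N i h) + C * (2 * N i h)"
      using C mid by (intro add_left_mono mult_left_mono)
    finally show "N i (?a - ?b) \<le> e * (N i ?a + N i h) + 2 * C * N i h" by simp
  qed
  then show ?thesis using C by (intro exI[of _ "2 * C"]) auto
qed

definition track :: "'z \<Rightarrow> nat \<Rightarrow> real \<Rightarrow> 'z" where
  "track f n t = \<phi> n f + t *\<^sub>R (\<phi> (Suc n) f - \<phi> n f)"

lemma track_in [simp]: "f \<in> D \<Longrightarrow> track f n t \<in> D"
  by (auto simp: track_def)

lemma track_0 [simp]: "track f n 0 = \<phi> n f" and track_1 [simp]: "track f n 1 = \<phi> (Suc n) f"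
  by (simp_all add: track_def)

lemma track_velocity: "f \<in> D \<Longrightarrow> \<phi> (Suc n) f - \<phi> n f \<in> K n"
  using K_closed(2)[OF \<phi>_coset[of f n], of "f - \<phi> (Suc n) f"] \<phi>_coset[of f "Suc n"] K(3)[of n]
  by auto

lemma track_coset: "f \<in> D \<Longrightarrow> f - track f n t \<in> K n"
  using K_closed(2)[OF \<phi>_coset[of f n] K_closed(3)[OF track_velocity[of f n], of t]]
  by (simp add: track_def algebra_simps)

text \<open>
  A convex function on \<open>[0, \<infinity>)\<close> with its minimum at \<open>0\<close> is nondecreasing.
\<close>

lemma N_track_mono:
  assumes f: "f \<in> D" and "0 \<le> t" "t \<le> s"
  shows "N i (track f n t) \<le> N i (track f n s)"
proof (cases "s = 0")
  case True
  then show ?thesis using assms by simp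
next
  case False
  then have s: "s > 0" "0 \<le> t/s" "t/s \<le> 1" using assms by auto
  have min: "N i (\<phi> n f) \<le> N i (track f n s)"
    unfolding track_def by (intro \<phi>_min K_closed track_velocity f)
  have "track f n t = (1 - t/s) *\<^sub>R \<phi> n f + (t/s) *\<^sub>R track f n s"
    using s by (simp add: track_def algebra_simps)
  then have "N i (track f n t) \<le> N i ((1 - t/s) *\<^sub>R \<phi> n f) + N i ((t/s) *\<^sub>R track f n s)"
    using N_triangle[of "(1 - t/s) *\<^sub>R \<phi> n f" "(t/s) *\<^sub>R track f n s" i] f by simp
  also have "\<dots> = (1 - t/s) * N i (\<phi> n f) + (t/s) * N i (track f n s)"
    using s f by (simp add: N_scale del: abs_divide)
  also have "\<dots> \<le> (1 - t/s) * N i (track f n s) + (t/s) * N i (track f n s)"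
    using s min by (intro add_right_mono mult_left_mono) auto
  also have "\<dots> = N i (track f n s)" by (simp add: algebra_simps)
  finally show ?thesis .
qed

lemma obtuse_track:
  assumes "f \<in> D" "0 \<le> t" "t \<le> u"
  shows "obtuse (track f n t) (track f n u)"
proof -
  have "(1/2) *\<^sub>R (track f n t + track f n u) = track f n ((t + u) / 2)"
  proof -
    have "\<phi> n f = (1/2) *\<^sub>R \<phi> n f + (1/2) *\<^sub>R \<phi> n f" by (simp flip: scaleR_add_left)
    then show ?thesis by (simp add: track_def algebra_simps add_divide_distrib)
  qed
  then show ?thesis
    using assms N_track_mono[OF assms] N_track_mono[of f t "(t + u) / 2"]
    by (simp add: obtuse_def)
qed


text \<open>
  From a point of the \<open>n\<close>-th segment to a later one, or to any element of \<open>f + K (Suc n)\<close>, such as \<open>f\<close>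
  itself, there are at most two obtuse steps, with \<open>\<phi> (Suc n) f\<close> as the possible stop between them.
  The differences of norms telescope.
\<close>

lemma track_close:
  assumes "0 < e"
  shows "\<exists>C\<ge>0. \<forall>f n t b. f \<in> D \<longrightarrow> 0 \<le> t \<longrightarrow> t \<le> 1 \<longrightarrow> 
    b \<in> D \<and> f - b \<in> K (Suc n) \<or> (\<exists>u\<ge>t. b = track f n u) \<longrightarrow>
    nn (track f n t) \<le> nn b \<and> nn (track f n t - b) \<le> e * nn b + C * (nn b - nn (track f n t))"
proof -
  obtain C where C: "C \<ge> 0" and
    close: "\<And>a b. obtuse a b \<Longrightarrow> nn (a - b) \<le> e/2 * nn b + C * (nn b - nn a)"
    using obtuse_close[of "e/2"] assms by auto
  have *: "nn a \<le> nn b \<and> nn (a - b) \<le> e * nn b + C * (nn b - nn a)"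
    if "obtuse a c" "obtuse c b" for a b c
  proof -
    have le: "nn a \<le> nn c" "nn c \<le> nn b"
      using that obtuse_nn_le by blast+
    have "nn (a - b) \<le> nn (a - c) + nn (c - b)"
      using that by (intro nn_diff_triangle) (auto simp: obtuse_def)
    also have "\<dots> \<le> (e/2 * nn c + C * (nn c - nn a)) + (e/2 * nn b + C * (nn b - nn c))"
      using that by (intro add_mono close)
    also have "\<dots> = e/2 * nn c + e/2 * nn b + C * (nn b - nn a)"
      by (simp add: algebra_simps)
    also have "\<dots> \<le> e/2 * nn b + e/2 * nn b + C * (nn b - nn a)"
      using assms le(2) by (intro add_right_mono mult_left_mono) auto
    finally show ?thesis using le by simp
  qed
  have "nn (track f n t) \<le> nn b \<and> nn (track f n t - b) \<le> e * nn b + C * (nn b - nn (track f n t))"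
    if f: "f \<in> D" and t: "0 \<le> t" "t \<le> 1"
      and b: "b \<in> D \<and> f - b \<in> K (Suc n) \<or> (\<exists>u\<ge>t. b = track f n u)" for f n t b
    using b
  proof
    assume "b \<in> D \<and> f - b \<in> K (Suc n)"
    then show ?thesis
      using *[OF _ obtuse_projection[of f b "Suc n"]] obtuse_track[OF f t, of n] f by simp
  next
    assume "\<exists>u\<ge>t. b = track f n u"
    then obtain u where u: "t \<le> u" "b = track f n u" by blast
    show ?thesis
      using *[OF obtuse_track[OF f t(1) u(1)] obtuse_track[OF f _ order_refl]] t u by auto
  qed
  then show ?thesis using C by blast
qed

definition on_track :: "'z \<Rightarrow> 'z \<Rightarrow> bool" where
  "on_track f a \<longleftrightarrow> (\<exists>n t. 0 \<le> t \<and> t \<le> 1 \<and> a = track f n t)"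

lemma on_track_in: "f \<in> D \<Longrightarrow> on_track f a \<Longrightarrow> a \<in> D"
  by (auto simp: on_track_def)

lemma track_reaches_sphere:
  assumes f: "f \<in> D" and "1 < nn f"
  shows "\<exists>a. on_track f a \<and> nn a = 1"
proof -
  \<comment> \<open>The segment that ends at the first projection outside the ball crosses the sphere.\<close>
  have "\<exists>n. 1 < nn (\<phi> n f)"
    using exhaustion[OF f, of 1] assms(2) by (meson not_le)
  then have "1 < nn (\<phi> (LEAST n. 1 < nn (\<phi> n f)) f)" (is "1 < nn (\<phi> ?m f)")
    by (rule LeastI_ex)
  moreover have "nn (\<phi> 0 f) = 0"
  proof -
    have "nn (\<phi> 0 f) \<le> nn 0"
      using f \<phi>_min[OF f, of "- \<phi> 0 f" 0] K(4) by (intro nn_le_if_N_le) auto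
    then show ?thesis using nn_nonneg[of "\<phi> 0 f"] f by simp
  qed
  ultimately obtain n where n: "?m = Suc n"
    by (metis not0_implies_Suc not_one_less_zero)
  have "nn (\<phi> n f) \<le> 1"
    using not_less_Least[of n "\<lambda>n. 1 < nn (\<phi> n f)"] n by auto
  moreover have "1 < nn (\<phi> (Suc n) f)"
    using \<open>1 < nn (\<phi> ?m f)\<close> n by simp
  moreover have "continuous_on {0..1} (\<lambda>t. nn (track f n t))"
  proof (rule lipschitz_on_continuous_on[OF lipschitz_onI])
    fix s t :: real
    have "track f n s - track f n t = (s - t) *\<^sub>R (\<phi> (Suc n) f - \<phi> n f)"
      by (simp add: track_def algebra_simps)
    then show "dist (nn (track f n s)) (nn (track f n t)) \<le> nn (\<phi> (Suc n) f - \<phi> n f) * dist s t"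
      using nn_diff_le[of "track f n s" "track f n t"] f
      by (simp add: nn_scale dist_real_def mult.commute)
  qed (use f in \<open>auto intro: nn_nonneg\<close>)
  ultimately have "\<exists>t\<ge>0. t \<le> 1 \<and> nn (track f n t) = 1"
    by (intro IVT') auto
  then show ?thesis unfolding on_track_def by blast
qed

definition retr :: "'z \<Rightarrow> 'z" where
  "retr f = (if nn f \<le> 1 then f else SOME a. on_track f a \<and> nn a = 1)"

lemma retr_outside:
  assumes "f \<in> D" "1 < nn f"
  shows "on_track f (retr f)" "nn (retr f) = 1"
  using someI_ex[OF track_reaches_sphere[OF assms]] assms(2) by (simp_all add: retr_def)

lemma retr_inside: "nn f \<le> 1 \<Longrightarrow> retr f = f"
  by (simp add: retr_def)

lemma retr_in: "f \<in> D \<Longrightarrow> retr f \<in> D"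
  using retr_outside(1) retr_inside on_track_in by (metis not_le)

lemma nn_retr_le: "f \<in> D \<Longrightarrow> nn (retr f) \<le> 1"
  using retr_outside(2) retr_inside by (metis not_le order_refl)

text \<open>
  The point \<open>a\<close> and the retract are comparable on the track, with norms that differ by at most \<open>\<eta>\<close>.
  If \<open>nn f \<le> 1\<close>, the retract is the end \<open>f\<close> of the track, and \<open>nn a \<le> nn f \<le> 1\<close>.
\<close>

lemma near_sphere_imp_near_retr:
  assumes "0 < e"
  shows "\<exists>\<eta>>0. \<forall>f a. f \<in> D \<longrightarrow> on_track f a \<longrightarrow> \<bar>nn a - 1\<bar> \<le> \<eta> \<longrightarrow> nn (a - retr f) \<le> e"
proof -
  obtain C where C: "C \<ge> 0" and close: "\<And>f n t b. f \<in> D \<Longrightarrow> 0 \<le> t \<Longrightarrow> t \<le> 1 \<Longrightarrow> 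
    b \<in> D \<and> f - b \<in> K (Suc n) \<or> (\<exists>u\<ge>t. b = track f n u) \<Longrightarrow>
    nn (track f n t) \<le> nn b \<and> nn (track f n t - b) \<le> e/4 * nn b + C * (nn b - nn (track f n t))"
    using track_close[of "e/4"] assms by (metis zero_less_divide_iff zero_less_numeral)
  define \<eta> where "\<eta> = min 1 (e / (2 * (C + 1)))"
  have \<eta>: "\<eta> > 0" "\<eta> \<le> 1" "C * \<eta> \<le> e/2"
  proof -
    have "C * \<eta> \<le> (C + 1) * (e / (2 * (C + 1)))"
      unfolding \<eta>_def using C assms by (intro mult_mono) auto
    also have "\<dots> = e/2" using C by (simp add: field_simps)
    finally show "C * \<eta> \<le> e/2" .
  qed (use C assms in \<open>auto simp: \<eta>_def\<close>)
  have bound: "x \<le> e" if "x \<le> e/4 * c + C * d" "c \<le> 1 + \<eta>" "d \<le> \<eta>" for x c d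
  proof -
    have "e/4 * c \<le> e/4 * 2" using that(2) \<eta>(2) assms by (intro mult_left_mono) auto
    moreover have "C * d \<le> C * \<eta>" using that(3) C by (intro mult_left_mono)
    ultimately show ?thesis using that(1) \<eta>(3) by linarith
  qed
  have "nn (a - retr f) \<le> e"
    if f: "f \<in> D" and a: "on_track f a" and near: "\<bar>nn a - 1\<bar> \<le> \<eta>" for f a
  proof -
    obtain n t where nt: "0 \<le> t" "t \<le> 1" "a = track f n t"
      using a by (auto simp: on_track_def)
    show ?thesis
    proof (cases "nn f \<le> 1")
      case True
      have "nn (a - f) \<le> e/4 * nn f + C * (nn f - nn a)"
        using close[OF f nt(1,2), of f n] f nt(3) K_closed(5) by auto
      from bound[OF this] show ?thesis
        using True near \<eta>(1) by (auto simp: retr_inside)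
    next
      case False
      then obtain m u where mu: "0 \<le> u" "u \<le> 1" "retr f = track f m u" and b: "nn (retr f) = 1"
        using retr_outside[of f] f by (auto simp: on_track_def)
      have coset: "f - track f k s \<in> K (Suc j)" if "j < k" for j k s
        using track_coset[OF f, of k s] K_antimono[of "Suc j" k] that by auto
      consider "n < m" | "m < n" | "n = m" "t \<le> u" | "n = m" "u \<le> t" by linarith
      then show ?thesis
      proof cases
        case 1
        then have "nn (a - retr f) \<le> e/4 * nn (retr f) + C * (nn (retr f) - nn a)"
          using close[OF f nt(1,2), of "retr f" n] mu f nt(3) coset by auto
        from bound[OF this] show ?thesis using b near \<eta>(1) by auto
      next
        case 2
        then have "nn (retr f - a) \<le> e/4 * nn a + C * (nn a - nn (retr f))"
          using close[OF f mu(1,2), of a m] mu f nt(3) coset by auto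
        from bound[OF this] have "nn (retr f - a) \<le> e" using b near \<eta>(1) by auto
        then show ?thesis using nn_minus[of a "retr f"] nt mu f by simp
      next
        case 3
        then have "nn (a - retr f) \<le> e/4 * nn (retr f) + C * (nn (retr f) - nn a)"
          using close[OF f nt(1,2), of "retr f" n] mu f nt(3) by auto
        from bound[OF this] show ?thesis using b near \<eta>(1) by auto
      next
        case 4
        then have "nn (retr f - a) \<le> e/4 * nn a + C * (nn a - nn (retr f))"
          using close[OF f mu(1,2), of a m] mu f nt(3) by auto
        from bound[OF this] have "nn (retr f - a) \<le> e" using b near \<eta>(1) by auto
        then show ?thesis using nn_minus[of a "retr f"] nt mu f by simp
      qed
    qed
  qed
  then show ?thesis using \<eta>(1) by blast
qed

text \<open>
  The endpoint \<open>\<phi> (Suc n) f\<close> of the segment may be arbitrarily long, and projections need not be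
  uniformly continuous on unbounded sets. But when the point with parameter \<open>t\<close> lies in the unit ball,
  \<open>t\<close> times that endpoint has norm at most \<open>2\<close>, and only this multiple matters.
\<close>

lemma track_stable:
  assumes "0 < e"
  shows "\<exists>d>0. \<forall>n t f g h. f \<in> D \<longrightarrow> g \<in> D \<longrightarrow> h \<in> D \<longrightarrow> 0 \<le> t \<longrightarrow> t \<le> 1 \<longrightarrow>
    f - g - h \<in> K (Suc n) \<longrightarrow> nn (track f n t) \<le> 1 \<longrightarrow> nn h \<le> d \<longrightarrow>
    nn (track f n t - track g n t) \<le> e"
proof -
  obtain C where C: "C \<ge> 0" and stable: "\<And>n f g h. f \<in> D \<Longrightarrow> g \<in> D \<Longrightarrow> h \<in> D \<Longrightarrow>
      f - g - h \<in> K n \<Longrightarrow> nn (\<phi> n f - \<phi> n g) \<le> e/6 * (nn (\<phi> n f) + nn h) + C * nn h"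
    using projection_stable[of "e/6"] assms by fastforce
  define d where "d = e / (2 * (e/6 + C))"
  have d: "d > 0" "(e/6 + C) * d = e/2"
    using C assms by (auto simp: d_def field_simps add_pos_nonneg)
  have "nn (track f n t - track g n t) \<le> e"
    if f: "f \<in> D" and g: "g \<in> D" and h: "h \<in> D" and t: "0 \<le> t" "t \<le> 1"
      and k: "f - g - h \<in> K (Suc n)" and ball: "nn (track f n t) \<le> 1" and hd: "nn h \<le> d"
    for n t f g h
  proof -
    let ?A = "\<phi> n f" and ?B = "\<phi> (Suc n) f"
    have A1: "nn ?A \<le> 1"
      using obtuse_nn_le[OF obtuse_track[OF f order_refl t(1)], of n] ball by simp
    have tB: "t * nn ?B \<le> 1 + (1 - t) * nn ?A"
    proof -
      have "t *\<^sub>R ?B = track f n t + (t - 1) *\<^sub>R ?A"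
        by (simp add: track_def algebra_simps)
      then have "nn (t *\<^sub>R ?B) \<le> nn (track f n t) + nn ((t - 1) *\<^sub>R ?A)"
        using nn_triangle[of "track f n t" "(t - 1) *\<^sub>R ?A"] f by auto
      then show ?thesis using t ball f by (simp add: nn_scale)
    qed
    have "track f n t - track g n t = (1 - t) *\<^sub>R (?A - \<phi> n g) + t *\<^sub>R (?B - \<phi> (Suc n) g)"
      by (simp add: track_def algebra_simps)
    then have "nn (track f n t - track g n t)
        \<le> (1 - t) * nn (?A - \<phi> n g) + t * nn (?B - \<phi> (Suc n) g)"
      using nn_triangle[of "(1 - t) *\<^sub>R (?A - \<phi> n g)" "t *\<^sub>R (?B - \<phi> (Suc n) g)"] f g t
      by (simp add: nn_scale)
    also have "\<dots> \<le> (1 - t) * (e/6 * (nn ?A + nn h) + C * nn h)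
        + t * (e/6 * (nn ?B + nn h) + C * nn h)"
      using k K(3)[of n] t by (intro add_mono mult_left_mono stable f g h) auto
    also have "\<dots> = e/6 * ((1 - t) * nn ?A + t * nn ?B) + (e/6 + C) * nn h"
      by (simp add: field_simps)
    also have "\<dots> \<le> e/6 * 3 + (e/6 + C) * d"
    proof (intro add_mono mult_left_mono hd)
      have "(1 - t) * nn ?A \<le> 1 * 1"
        using A1 t nn_nonneg[of ?A] f by (intro mult_mono) auto
      then show "(1 - t) * nn ?A + t * nn ?B \<le> 3" using tB by linarith
    qed (use C assms in auto)
    also have "\<dots> = e" using d by simp
    finally show ?thesis .
  qed
  then show ?thesis using d(1) by blast
qed

lemma sphere_to_retr:
  assumes "0 < e"
  shows "\<exists>d>0. \<forall>n t f g h. f \<in> D \<longrightarrow> g \<in> D \<longrightarrow> h \<in> D \<longrightarrow> 0 \<le> t \<longrightarrow> t \<le> 1 \<longrightarrow>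
    f - g - h \<in> K (Suc n) \<longrightarrow> nn (track f n t) = 1 \<longrightarrow> nn h \<le> d \<longrightarrow>
    nn (track f n t - retr g) \<le> e"
proof -
  obtain \<eta> where \<eta>: "\<eta> > 0"
    "\<And>f a. f \<in> D \<Longrightarrow> on_track f a \<Longrightarrow> \<bar>nn a - 1\<bar> \<le> \<eta> \<Longrightarrow> nn (a - retr f) \<le> e/2"
    using near_sphere_imp_near_retr[of "e/2"] assms by auto
  obtain d where d: "d > 0" "\<And>n t f g h. f \<in> D \<Longrightarrow> g \<in> D \<Longrightarrow> h \<in> D \<Longrightarrow> 0 \<le> t \<Longrightarrow> t \<le> 1 \<Longrightarrow>
    f - g - h \<in> K (Suc n) \<Longrightarrow> nn (track f n t) \<le> 1 \<Longrightarrow> nn h \<le> d \<Longrightarrow>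
    nn (track f n t - track g n t) \<le> min \<eta> (e/2)"
    using track_stable[of "min \<eta> (e/2)"] \<eta>(1) assms by auto
  have "nn (track f n t - retr g) \<le> e"
    if "f \<in> D" "g \<in> D" "h \<in> D" "0 \<le> t" "t \<le> 1"
      "f - g - h \<in> K (Suc n)" "nn (track f n t) = 1" "nn h \<le> d" for n t f g h
  proof -
    have close: "nn (track f n t - track g n t) \<le> min \<eta> (e/2)"
      using d(2)[of f g h t n] that by simp
    then have "\<bar>nn (track g n t) - 1\<bar> \<le> \<eta>"
      using nn_diff_le[of "track f n t" "track g n t"] that by auto
    then have "nn (track g n t - retr g) \<le> e/2"
      using that by (intro \<eta>(2)) (auto simp: on_track_def)
    then show ?thesis
      using close nn_diff_triangle[of "track f n t" "track g n t" "retr g"] that retr_in by auto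
  qed
  then show ?thesis using d(1) by blast
qed

lemma retr_uniformly_continuous:
  assumes "0 < e"
  shows "\<exists>d>0. \<forall>f\<in>D. \<forall>g\<in>D. nn (f - g) < d \<longrightarrow> nn (retr f - retr g) < e"
proof -
  obtain d where d: "d > 0" "\<And>n t f g h. f \<in> D \<Longrightarrow> g \<in> D \<Longrightarrow> h \<in> D \<Longrightarrow> 0 \<le> t \<Longrightarrow> t \<le> 1 \<Longrightarrow>
    f - g - h \<in> K (Suc n) \<Longrightarrow> nn (track f n t) = 1 \<Longrightarrow> nn h \<le> d \<Longrightarrow>
    nn (track f n t - retr g) \<le> e/2"
    using sphere_to_retr[of "e/2"] assms by auto
  have *: "nn (retr f - retr g) < e"
    if fg: "f \<in> D" "g \<in> D" "nn (f - g) < d" and out: "1 < nn f" for f g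
  proof -
    obtain n t where "0 \<le> t" "t \<le> 1" "retr f = track f n t" "nn (retr f) = 1"
      using retr_outside[OF fg(1) out] by (auto simp: on_track_def)
    then show ?thesis
      using d(2)[of f g "f - g" t n] fg assms K_closed(5) by auto
  qed
  have "nn (retr f - retr g) < e" if "f \<in> D" "g \<in> D" "nn (f - g) < min d e" for f g
    using *[of f g] *[of g f] that nn_minus[of f g] nn_minus[of "retr f" "retr g"] retr_in
      retr_inside[of f] retr_inside[of g]
    by (cases "nn f \<le> 1"; cases "nn g \<le> 1") auto
  then show ?thesis using d(1) assms by (intro exI[of _ "min d e"]) auto
qed

text \<open>
  The alternative in the conclusion is the case in which the tails matter: \<open>retr f\<close> then need not be
  near \<open>f0\<close> in norm, but it takes the same values as \<open>f\<close> at the points that \<open>K m\<close> annihilates.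
\<close>

lemma retr_stable:
  assumes f0: "f0 \<in> D" and e: "0 < e"
  shows "\<exists>n. \<exists>d>0. \<forall>f\<in>D. \<forall>h\<in>D. f0 - f - h \<in> K n \<longrightarrow> nn h \<le> d \<longrightarrow>
    nn (retr f0 - retr f) \<le> e \<or> retr f0 = f0 \<and> f - retr f \<in> K m"
proof (cases "nn f0 \<le> 1")
  case False
  then obtain n t where nt: "0 \<le> t" "t \<le> 1" "retr f0 = track f0 n t" "nn (retr f0) = 1"
    using retr_outside[of f0] f0 by (auto simp: on_track_def)
  show ?thesis
    using sphere_to_retr[OF e] f0 nt by metis
next
  case True
  obtain \<eta> where \<eta>: "\<eta> > 0"
    "\<And>f a. f \<in> D \<Longrightarrow> on_track f a \<Longrightarrow> \<bar>nn a - 1\<bar> \<le> \<eta> \<Longrightarrow> nn (a - retr f) \<le> e/2"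
    using near_sphere_imp_near_retr[of "e/2"] e by auto
  define \<epsilon> where "\<epsilon> = min (\<eta>/2) (e/4)"
  have \<epsilon>: "\<epsilon> > 0" using \<eta>(1) e by (simp add: \<epsilon>_def)
  obtain d where d: "d > 0" "\<And>n t f g h. f \<in> D \<Longrightarrow> g \<in> D \<Longrightarrow> h \<in> D \<Longrightarrow> 0 \<le> t \<Longrightarrow> t \<le> 1 \<Longrightarrow>
    f - g - h \<in> K (Suc n) \<Longrightarrow> nn (track f n t) \<le> 1 \<Longrightarrow> nn h \<le> d \<Longrightarrow>
    nn (track f n t - track g n t) \<le> \<epsilon>"
    using track_stable[OF \<epsilon>] by auto
  obtain n where n: "m \<le> n" "nn (\<phi> n f0 - f0) \<le> \<epsilon>"
  proof -
    obtain C where C: "C \<ge> 0" and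
      close: "\<And>a b. obtuse a b \<Longrightarrow> nn (a - b) \<le> \<epsilon>/2 * nn b + C * (nn b - nn a)"
      using obtuse_close[of "\<epsilon>/2"] \<epsilon> by auto
    have "\<exists>k. nn f0 - \<epsilon> / (2 * (C + 1)) < nn (\<phi> k f0)"
    proof (rule ccontr)
      assume "\<not> ?thesis"
      then have "nn f0 \<le> nn f0 - \<epsilon> / (2 * (C + 1))"
        by (intro exhaustion[OF f0]) (simp add: not_less)
      moreover have "0 < \<epsilon> / (2 * (C + 1))" using \<epsilon> C by simp
      ultimately show False by linarith
    qed
    then obtain k where "nn f0 - \<epsilon> / (2 * (C + 1)) < nn (\<phi> k f0)" ..
    then have k: "nn f0 - nn (\<phi> k f0) < \<epsilon> / (2 * (C + 1))" by linarith
    let ?n = "max m k"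
    have ob: "obtuse (\<phi> ?n f0) f0"
      using f0 K_closed(5) by (intro obtuse_projection) auto
    \<comment> \<open>Passing from \<open>k\<close> to a larger index only increases the norm of the projection.\<close>
    have "nn (\<phi> k f0) \<le> nn (\<phi> ?n f0)"
      using f0 \<phi>_coset[OF f0, of ?n] K_antimono[of k ?n]
      by (intro obtuse_nn_le obtuse_projection) auto
    then have "C * (nn f0 - nn (\<phi> ?n f0)) \<le> (C + 1) * (\<epsilon> / (2 * (C + 1)))"
      using k C obtuse_nn_le[OF ob] by (intro mult_mono) auto
    also have "\<dots> = \<epsilon>/2" using C by (simp add: field_simps)
    finally have "nn (\<phi> ?n f0 - f0) \<le> \<epsilon>/2 * nn f0 + \<epsilon>/2"
      using close[OF ob] by linarith
    also have "\<dots> \<le> \<epsilon>" using mult_left_mono[OF True less_imp_le[OF \<epsilon>]] by linarith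
    finally show ?thesis using that[of ?n] by simp
  qed
  have "nn (retr f0 - retr f) \<le> e \<or> f - retr f \<in> K m"
    if f: "f \<in> D" and h: "h \<in> D" "nn h \<le> d" "f0 - f - h \<in> K (Suc n)" for f h
  proof (cases "nn f \<le> 1")
    case True
    then show ?thesis by (simp add: retr_inside K_closed(5))
  next
    case False
    then obtain k u where ku: "0 \<le> u" "u \<le> 1" "retr f = track f k u" "nn (retr f) = 1"
      using retr_outside[of f] f by (auto simp: on_track_def)
    show ?thesis
    proof (cases "n \<le> k")
      case True
      then show ?thesis
        using track_coset[OF f, of k u] K_antimono[of m k] n(1) ku(3) by auto
    next
      case False
      have "obtuse (track f k u) (\<phi> (Suc k) f)"
        using obtuse_track[OF f ku(1,2), of k] by simp
      moreover have "obtuse (\<phi> (Suc k) f) (\<phi> n f)"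
        using False f \<phi>_coset[OF f, of n] K_antimono[of "Suc k" n]
        by (intro obtuse_projection) auto
      ultimately have ge: "1 \<le> nn (\<phi> n f)"
        using obtuse_nn_le[of "track f k u"] obtuse_nn_le[of _ "\<phi> n f"] ku(3,4) by fastforce
      have "nn (track f0 n 0 - track f n 0) \<le> \<epsilon>"
        using nn_projection_le[OF f0, of n] \<open>nn f0 \<le> 1\<close> d(2)[OF f0 f h(1) order_refl _ h(3)] h(2)
        by simp
      then have close: "nn (f0 - \<phi> n f) \<le> 2 * \<epsilon>"
        using nn_diff_triangle[of f0 "\<phi> n f0" "\<phi> n f"] n(2) nn_minus[of f0 "\<phi> n f0"] f f0 by simp
      then have "nn (\<phi> n f) \<le> 1 + \<eta>"
        using nn_diff_le[of f0 "\<phi> n f"] f f0 \<open>nn f0 \<le> 1\<close> by (auto simp: \<epsilon>_def)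
      then have near: "\<bar>nn (\<phi> n f) - 1\<bar> \<le> \<eta>" using ge by linarith
      have "on_track f (\<phi> n f)"
        unfolding on_track_def by (intro exI[of _ n] exI[of _ 0]) simp
      then have "nn (\<phi> n f - retr f) \<le> e/2"
        using \<eta>(2)[OF f _ near] by blast
      then show ?thesis
        using close nn_diff_triangle[OF f0 \<phi>_in[OF f, of n] retr_in[OF f]]
          retr_inside[OF \<open>nn f0 \<le> 1\<close>] min.cobounded2[of "\<eta>/2" "e/4"]
        by (simp add: \<epsilon>_def)
    qed
  qed
  then show ?thesis
    using d(1) retr_inside[OF True] by metis
qed

end

section \<open>The dual of a c0-sum\<close>

text \<open>
  The rule \<open>conv\<close> is uniform convexity of the duals, uniformly in \<open>i\<close> and in additive form.
\<close>

locale c0_predual =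
  fixes X :: "nat \<Rightarrow> ('k::{real_normed_field,banach}, 'v::ab_group_add) nspace"
    and x :: "nat \<Rightarrow> nat \<Rightarrow> 'v"
  assumes X: "normed_space (X i)"
    and x_in: "x i k \<in> carr (X i)"
    and x_dense: "v \<in> carr (X i) \<Longrightarrow> 0 < e \<Longrightarrow> \<exists>k. nrm (X i) (v - x i k) < e"
    and conv: "0 < e \<Longrightarrow> \<exists>C\<ge>0. \<forall>i M. \<forall>a\<in>carr (dual (X i)). \<forall>b\<in>carr (dual (X i)).
      nrm (dual (X i)) a \<le> M \<longrightarrow> nrm (dual (X i)) b \<le> M \<longrightarrow>
      nrm (dual (X i)) (a - b) \<le> e * M + C * (M - nrm (dual (X i)) ((1/2) *\<^sub>R (a + b)))"
begin

abbreviation "S \<equiv> c0_sum X"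
abbreviation "D \<equiv> carr (dual S)"
abbreviation "dnorm \<equiv> nrm (dual S)"

lemmas S = normed_space_c0_sum[of X, OF X]
lemmas XD = normed_space_dual[OF X]
lemmas SD = normed_space_dual[OF S]

lemma coord_in: "z \<in> carr S \<Longrightarrow> z i \<in> carr (X i)"
  by (simp add: c0_sum_def)

lemma coord_le:
  assumes "z \<in> carr S"
  shows "nrm (X i) (z i) \<le> nrm S z"
proof -
  have "Bseq (\<lambda>i. nrm (X i) (z i))"
    using assms by (auto simp: c0_sum_def intro!: convergent_imp_Bseq convergentI)
  then have "bdd_above (range (\<lambda>i. nrm (X i) (z i)))"
    by (simp add: Bseq_eq_bounded bounded_imp_bdd_above)
  from cSUP_upper[OF UNIV_I this] show ?thesis by (simp add: c0_sum_def)
qed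

lemma c0_norm_least: "(\<And>i. nrm (X i) (z i) \<le> c) \<Longrightarrow> nrm S z \<le> c"
  by (auto simp: c0_sum_def intro: cSUP_least)

definition embed :: "nat \<Rightarrow> 'v \<Rightarrow> nat \<Rightarrow> 'v" where
  "embed i v = (\<lambda>j. if j = i then v else 0)"

definition truncate :: "nat \<Rightarrow> (nat \<Rightarrow> 'v) \<Rightarrow> nat \<Rightarrow> 'v" where
  "truncate n z = (\<lambda>i. if i < n then z i else 0)"

lemma finite_support_in:
  assumes "\<And>i. z i \<in> carr (X i)" "\<And>i. n \<le> i \<Longrightarrow> z i = 0"
  shows "z \<in> carr S"
proof -
  have "(\<lambda>i. nrm (X i) (z i)) \<longlonglongrightarrow> 0"
    using assms(2) ns_zero(2)[OF X]
    by (intro tendsto_eventually) (auto simp: eventually_sequentially intro!: exI[of _ n])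
  then show ?thesis using assms(1) by (simp add: c0_sum_def)
qed

lemma embed_in: "v \<in> carr (X i) \<Longrightarrow> embed i v \<in> carr S"
  by (rule finite_support_in[of _ "Suc i"]) (auto simp: embed_def ns_zero(1)[OF X])

lemma embed_in_iff: "embed i v \<in> carr S \<longleftrightarrow> v \<in> carr (X i)"
  using embed_in coord_in[of "embed i v" i] by (auto simp: embed_def)

lemma truncate_in: "(\<And>i. z i \<in> carr (X i)) \<Longrightarrow> truncate n z \<in> carr S"
  by (rule finite_support_in[of _ n]) (auto simp: truncate_def ns_zero(1)[OF X])

lemma nrm_embed_le:
  assumes "v \<in> carr (X i)"
  shows "nrm S (embed i v) \<le> nrm (X i) v"
  using ns_nonneg[OF X assms] ns_zero(2)[OF X]
  by (intro c0_norm_least) (auto simp: embed_def)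

lemma truncate_approx:
  assumes z: "z \<in> carr S" and "0 < e"
  shows "\<exists>n. nrm S (z - truncate n z) \<le> e"
proof -
  have "\<forall>\<^sub>F i in sequentially. nrm (X i) (z i) < e"
    using z \<open>0 < e\<close> by (auto simp: c0_sum_def intro: order_tendstoD)
  then obtain n where "\<And>i. i \<ge> n \<Longrightarrow> nrm (X i) (z i) < e"
    by (auto simp: eventually_sequentially)
  then have "nrm S (z - truncate n z) \<le> e"
    using ns_zero(2)[OF X] \<open>0 < e\<close>
    by (intro c0_norm_least) (auto simp: truncate_def not_less intro: less_imp_le)
  then show ?thesis ..
qed

definition component :: "nat \<Rightarrow> ((nat \<Rightarrow> 'v) \<Rightarrow> 'k) \<Rightarrow> 'v \<Rightarrow> 'k" where
  "component i f = (\<lambda>v. f (embed i v))"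

abbreviation "cnorm i f \<equiv> nrm (dual (X i)) (component i f)"

lemma component_in:
  assumes f: "f \<in> D"
  shows "component i f \<in> carr (dual (X i))"
proof -
  have "component i f \<in> carr (dual (X i)) \<and> cnorm i f \<le> dnorm f"
  proof (rule dualI[OF X])
    fix v w assume vw: "v \<in> carr (X i)" "w \<in> carr (X i)"
    have "embed i (v + w) = embed i v + embed i w" by (auto simp: embed_def)
    then show "component i f (v + w) = component i f v + component i f w"
      using dual_add[OF f embed_in[OF vw(1)] embed_in[OF vw(2)]] by (simp add: component_def)
  next
    fix c v assume v: "v \<in> carr (X i)"
    have "embed i (smul (X i) c v) = smul S c (embed i v)"
    proof -
      have "smul (X j) c 0 = 0" for j
        using ns_eq_0[OF X ns_smul[OF X ns_zero(1)[OF X]]] ns_nrm_smul[OF X ns_zero(1)[OF X]]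
          ns_zero(2)[OF X] by simp
      then show ?thesis by (auto simp: embed_def c0_sum_def)
    qed
    then show "component i f (smul (X i) c v) = c * component i f v"
      using dual_smul[OF f embed_in[OF v]] by (simp add: component_def)
  next
    fix v assume "v \<notin> carr (X i)"
    then show "component i f v = 0"
      using dual_off[OF f] by (simp add: component_def embed_in_iff)
  next
    fix v assume v: "v \<in> carr (X i)"
    show "norm (component i f v) \<le> dnorm f * nrm (X i) v"
      using dual_norm_apply[OF S f embed_in[OF v]]
        mult_left_mono[OF nrm_embed_le[OF v] ns_nonneg[OF SD f]]
      by (simp add: component_def)
  qed (rule ns_nonneg[OF SD f])
  then show ?thesis ..
qed

lemma component_linear:
  "component i (f + g) = component i f + component i g"
  "component i (f - g) = component i f - component i g"
  "component i (c *\<^sub>R f) = c *\<^sub>R component i f"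
  by (simp_all add: component_def fun_eq_iff)

lemma truncate_apply:
  assumes f: "f \<in> D" and z: "\<And>i. z i \<in> carr (X i)"
  shows "f (truncate n z) = (\<Sum>i<n. component i f (z i))"
proof (induction n)
  case 0
  have zero: "truncate 0 z = 0" by (simp add: truncate_def fun_eq_iff)
  have "f (0 - 0) = 0" using dual_diff[OF S f ns_zero(1)[OF S] ns_zero(1)[OF S]] by simp
  then show ?case unfolding zero by (simp add: zero_fun_def)
next
  case (Suc n)
  have step: "truncate (Suc n) z = truncate n z + embed n (z n)"
    by (auto simp: truncate_def embed_def fun_eq_iff)
  have "f (truncate (Suc n) z) = f (truncate n z) + f (embed n (z n))"
    unfolding step by (rule dual_add[OF f truncate_in[of z, OF z] embed_in[OF z]])
  then show ?case
    using Suc by (simp add: component_def)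
qed

text \<open>
  For the partial sums, choose almost norming vectors \<open>u i\<close> in the unit balls, rotated so that the components take real
  values on them; the vector with coordinates \<open>u 0, \<dots>, u (n - 1)\<close> lies in the unit ball of the
  \<open>c\<^sub>0\<close>-sum. The converse estimate holds on truncations, which approximate every vector.
\<close>

lemma cnorm_sums:
  assumes f: "f \<in> D"
  shows "(\<lambda>i. cnorm i f) sums dnorm f"
proof -
  have nonneg: "0 \<le> cnorm i f" for i by (rule ns_nonneg[OF XD component_in[OF f]])
  have partial: "(\<Sum>i<n. cnorm i f) \<le> dnorm f" for n
  proof (rule field_le_epsilon)
    fix e :: real assume "0 < e"
    define e' where "e' = e / (real n + 1)"
    have e': "e' > 0" "n * e' \<le> e" using \<open>0 < e\<close> by (auto simp: e'_def field_simps)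
    have "\<exists>u\<in>closed_unit_ball (X i). \<exists>c\<ge>cnorm i f - e'. component i f u = of_real c" for i
    proof -
      have "\<exists>v\<in>closed_unit_ball (X i). cnorm i f - e' < norm (component i f v)"
      proof (rule ccontr)
        assume "\<not> ?thesis"
        then have "cnorm i f \<le> cnorm i f - e'"
          by (intro dual_norm_least[OF X]) (auto simp: not_less)
        then show False using e'(1) by simp
      qed
      then obtain v where v: "v \<in> carr (X i)" "nrm (X i) v \<le> 1"
        and big: "cnorm i f - e' < norm (component i f v)"
        by (auto simp: closed_unit_ball_def)
      \<comment> \<open>If the value is \<open>0\<close>, division by zero makes the rotated vector \<open>0\<close>, which still serves.\<close>
      let ?w = "component i f v"
      let ?c = "of_real (norm ?w) / ?w"
      have "component i f (smul (X i) ?c v) = of_real (norm ?w)"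
        using dual_smul[OF component_in[OF f] v(1)] by (cases "?w = 0") auto
      moreover have "norm ?c \<le> 1" by (simp add: norm_divide)
      then have "smul (X i) ?c v \<in> closed_unit_ball (X i)"
        using v ns_smul[OF X v(1)] ns_nrm_smul[OF X v(1)] ns_nonneg[OF X v(1)]
        by (simp add: closed_unit_ball_def mult_le_one del: norm_divide)
      ultimately show ?thesis using big by (intro bexI exI[of _ "norm ?w"]) auto
    qed
    then obtain u c where u: "\<And>i. u i \<in> closed_unit_ball (X i)"
      and c: "\<And>i. cnorm i f - e' \<le> c i" "\<And>i. component i f (u i) = of_real (c i)" by metis
    have u_in: "u i \<in> carr (X i)" for i using u by (simp add: closed_unit_ball_def)
    have "nrm S (truncate n u) \<le> 1"
      using u ns_zero(2)[OF X] by (intro c0_norm_least) (auto simp: truncate_def closed_unit_ball_def)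
    then have "truncate n u \<in> closed_unit_ball S"
      using truncate_in[of u, OF u_in] by (simp add: closed_unit_ball_def)
    from dual_norm_upper(2)[OF S f this] have "norm (of_real (\<Sum>i<n. c i) :: 'k) \<le> dnorm f"
      by (simp add: truncate_apply[OF f u_in] c(2))
    then have "(\<Sum>i<n. c i) \<le> dnorm f" by (simp only: norm_of_real)
    moreover have "(\<Sum>i<n. cnorm i f - e') \<le> (\<Sum>i<n. c i)" by (intro sum_mono c(1))
    ultimately show "(\<Sum>i<n. cnorm i f) \<le> dnorm f + e"
      using e'(2) by (simp add: sum_subtractf)
  qed
  then have summable: "summable (\<lambda>i. cnorm i f)"
    by (intro summableI_nonneg_bounded[OF nonneg])
  have "dnorm f \<le> (\<Sum>i. cnorm i f)"
  proof (rule dual_norm_least[OF S], rule field_le_epsilon)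
    fix z and e :: real assume "z \<in> closed_unit_ball S" "0 < e"
    then have z: "z \<in> carr S" "nrm S z \<le> 1" by (auto simp: closed_unit_ball_def)
    define e' where "e' = e / (dnorm f + 1)"
    have e': "e' > 0" "dnorm f * e' \<le> e"
      using \<open>0 < e\<close> ns_nonneg[OF SD f] by (auto simp: e'_def field_simps add_pos_nonneg)
    obtain n where n: "nrm S (z - truncate n z) \<le> e'"
      using truncate_approx[OF z(1) e'(1)] by blast
    note tr = truncate_in[of z, OF coord_in[OF z(1)]]
    have "norm (f (truncate n z)) \<le> (\<Sum>i<n. norm (component i f (z i)))"
      unfolding truncate_apply[OF f coord_in[OF z(1)]] by (rule norm_sum)
    also have "\<dots> \<le> (\<Sum>i<n. cnorm i f)"
    proof (intro sum_mono)
      fix i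
      have "z i \<in> closed_unit_ball (X i)"
        using coord_in[OF z(1)] coord_le[OF z(1), of i] z(2) by (simp add: closed_unit_ball_def)
      then show "norm (component i f (z i)) \<le> cnorm i f"
        by (rule dual_norm_upper(2)[OF X component_in[OF f]])
    qed
    also have "\<dots> \<le> (\<Sum>i. cnorm i f)" by (intro sum_le_suminf summable nonneg) auto
    finally have head: "norm (f (truncate n z)) \<le> (\<Sum>i. cnorm i f)" .
    have "norm (f (z - truncate n z)) \<le> dnorm f * e'"
      using dual_norm_apply[OF S f ns_diff[OF S z(1) tr[of n]]]
        mult_left_mono[OF n ns_nonneg[OF SD f]] by linarith
    then have "norm (f z - f (truncate n z)) \<le> e"
      using dual_diff[OF S f z(1) tr[of n]] e'(2) by simp
    then show "norm (f z) \<le> (\<Sum>i. cnorm i f) + e"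
      using head norm_triangle_ineq2[of "f z" "f (truncate n z)"] by linarith
  qed
  moreover have "(\<Sum>i. cnorm i f) \<le> dnorm f"
    by (intro suminf_le_const summable partial)
  ultimately show ?thesis using summable_sums[OF summable] by simp
qed

definition K :: "nat \<Rightarrow> ((nat \<Rightarrow> 'v) \<Rightarrow> 'k) set" where
  "K n = {g \<in> D. \<forall>i<n. \<forall>k<n. g (embed i (x i k)) = 0}"

lemma K_subspace: "subspace (K n)"
  using subspace_dual[OF S] by (auto simp: K_def subspace_def)

lemma approx_in_span:
  assumes z: "z \<in> carr S" and "0 < e"
  shows "\<exists>y\<in>carr S. nrm S (z - y) \<le> e \<and> (\<exists>m. \<forall>n\<ge>m. \<forall>g\<in>K n. g y = 0)"
proof -
  obtain j where j: "nrm S (z - truncate j z) \<le> e"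
    using truncate_approx[OF assms] by blast
  obtain k where k: "\<And>i. nrm (X i) (z i - x i (k i)) < e"
    using x_dense[OF coord_in[OF z] \<open>0 < e\<close>] by metis
  define y where "y = truncate j (\<lambda>i. x i (k i))"
  have y: "y \<in> carr S" unfolding y_def by (rule truncate_in) (rule x_in)
  have "nrm S (z - y) \<le> e"
  proof (rule c0_norm_least)
    fix i
    show "nrm (X i) ((z - y) i) \<le> e"
    proof (cases "i < j")
      case True
      then show ?thesis using k[of i] by (simp add: y_def truncate_def)
    next
      case False
      have "z - truncate j z \<in> carr S"
        using ns_diff[OF S z truncate_in[of z]] coord_in[OF z] by blast
      from coord_le[OF this, of i] show ?thesis
        using j False by (simp add: y_def truncate_def)
    qed
  qed
  moreover have "g y = 0" if n: "n \<ge> Suc (Max (insert j (k ` {..<j})))" and g: "g \<in> K n" for n g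
  proof -
    have "a < n" if "a \<in> insert j (k ` {..<j})" for a
      using Max_ge[OF _ that] n by simp
    then have "i < n" "k i < n" if "i < j" for i
      using that by (auto intro: less_trans)
    then have "component i g (x i (k i)) = 0" if "i < j" for i
      using g that by (simp add: K_def component_def)
    then show ?thesis
      using truncate_apply[of g "\<lambda>i. x i (k i)" j] g x_in by (simp add: y_def K_def)
  qed
  ultimately show ?thesis using y by blast
qed

text \<open>
  The conditions that define \<open>K n\<close> concern one component at a time, so the minimal extensions
  of the components for \<open>i < n\<close> may be chosen independently. Components with \<open>i \<ge> n\<close> are
  unconstrained and become \<open>0\<close>, so gluing is a finite sum.
\<close>

lemma componentwise_minimal:
  assumes f: "f \<in> D"
  shows "\<exists>a\<in>D. f - a \<in> K n \<and> (\<forall>h\<in>K n. \<forall>i. cnorm i a \<le> cnorm i (a + h))"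
proof -
  define extends where "extends i b \<longleftrightarrow> b \<in> carr (dual (X i)) \<and> (\<forall>y\<in>x i ` {..<n}. b y = component i f y)"
    for i b
  have "\<exists>a. extends i a \<and> (\<forall>b. extends i b \<longrightarrow> nrm (dual (X i)) a \<le> nrm (dual (X i)) b)" for i
  proof -
    have "\<exists>a\<in>carr (dual (X i)). (\<forall>y\<in>x i ` {..<n}. a y = component i f y) \<and>
      (\<forall>b\<in>carr (dual (X i)). (\<forall>y\<in>x i ` {..<n}. b y = component i f y) \<longrightarrow>
        nrm (dual (X i)) a \<le> nrm (dual (X i)) b)"
    proof (rule minimal_norm_extension[OF X _ component_in[OF f]])
      fix e :: real assume "0 < e"
      from conv[OF this] obtain C where "C \<ge> 0" and
        "\<forall>i M. \<forall>a\<in>carr (dual (X i)). \<forall>b\<in>carr (dual (X i)).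
        nrm (dual (X i)) a \<le> M \<longrightarrow> nrm (dual (X i)) b \<le> M \<longrightarrow>
        nrm (dual (X i)) (a - b) \<le> e * M + C * (M - nrm (dual (X i)) ((1/2) *\<^sub>R (a + b)))"
        by (elim exE conjE)
      then show "\<exists>C\<ge>0. \<forall>M. \<forall>a\<in>carr (dual (X i)). \<forall>b\<in>carr (dual (X i)).
        nrm (dual (X i)) a \<le> M \<longrightarrow> nrm (dual (X i)) b \<le> M \<longrightarrow>
        nrm (dual (X i)) (a - b) \<le> e * M + C * (M - nrm (dual (X i)) ((1/2) *\<^sub>R (a + b)))"
        by (intro exI[of _ C] conjI) (assumption, erule spec)
    qed
    then show ?thesis by (auto simp: extends_def Bex_def imp_conjL)
  qed
  then obtain a where a_ext: "\<And>i. extends i (a i)"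
    and a_min: "\<And>i b. extends i b \<Longrightarrow> nrm (dual (X i)) (a i) \<le> nrm (dual (X i)) b" by metis
  have a: "a i \<in> carr (dual (X i))" for i using a_ext by (simp add: extends_def)
  have a_eq: "a i (x i k) = component i f (x i k)" if "k < n" for i k
    using a_ext that by (simp add: extends_def)
  define A where "A = (\<lambda>z. if z \<in> carr S then \<Sum>i<n. a i (z i) else 0)"
  have "A \<in> D \<and> dnorm A \<le> (\<Sum>i<n. nrm (dual (X i)) (a i))"
  proof (rule dualI[OF S])
    fix z w assume zw: "z \<in> carr S" "w \<in> carr S"
    show "A (z + w) = A z + A w"
      using zw ns_add[OF S zw] dual_add[OF a coord_in[OF zw(1)] coord_in[OF zw(2)]]
      by (simp add: A_def sum.distrib)
  next
    fix c z assume z: "z \<in> carr S"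
    have "smul S c z i = smul (X i) c (z i)" for i by (simp add: c0_sum_def)
    then show "A (smul S c z) = c * A z"
      using z ns_smul[OF S z] dual_smul[OF a coord_in[OF z]] by (simp add: A_def sum_distrib_left)
  next
    fix z assume "z \<notin> carr S"
    then show "A z = 0" by (simp add: A_def)
  next
    fix z assume z: "z \<in> carr S"
    have "norm (A z) \<le> (\<Sum>i<n. norm (a i (z i)))" using z by (simp add: A_def norm_sum)
    also have "\<dots> \<le> (\<Sum>i<n. nrm (dual (X i)) (a i) * nrm S z)"
    proof (rule sum_mono)
      fix i
      show "norm (a i (z i)) \<le> nrm (dual (X i)) (a i) * nrm S z"
        using dual_norm_apply[OF X a coord_in[OF z]]
          mult_left_mono[OF coord_le[OF z] ns_nonneg[OF XD a]] order_trans by blast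
    qed
    finally show "norm (A z) \<le> (\<Sum>i<n. nrm (dual (X i)) (a i)) * nrm S z"
      by (simp add: sum_distrib_right)
  qed (intro sum_nonneg ns_nonneg[OF XD] a)
  then have A: "A \<in> D" ..
  have comp: "component i A = (if i < n then a i else 0)" for i
  proof
    fix v
    show "component i A v = (if i < n then a i else 0) v"
    proof (cases "v \<in> carr (X i)")
      case True
      have zero: "a j 0 = 0" for j
        using dual_diff[OF X a ns_zero(1)[OF X] ns_zero(1)[OF X]] by simp
      have "(\<Sum>j<n. a j (if j = i then v else 0)) = (\<Sum>j<n. if j = i then a i v else 0)"
        by (intro sum.cong) (auto simp: zero)
      then show ?thesis
        using embed_in[OF True] by (simp add: component_def A_def embed_def)
    next
      case False
      then show ?thesis
        using dual_off[OF a] by (simp add: component_def A_def embed_in_iff)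
    qed
  qed
  have "f - A \<in> K n"
  proof -
    have "(f - A) (embed i (x i k)) = component i f (x i k) - component i A (x i k)" for i k
      by (simp add: component_def)
    then show ?thesis
      using subspace_diff[OF subspace_dual[OF S] f A] a_eq comp by (simp add: K_def)
  qed
  moreover have "cnorm i A \<le> cnorm i (A + h)" if h: "h \<in> K n" for h i
  proof (cases "i < n")
    case True
    have hD: "h \<in> D" using h by (simp add: K_def)
    have "nrm (dual (X i)) (a i) \<le> cnorm i (A + h)"
    proof (rule a_min, unfold extends_def, intro conjI ballI)
      show "component i (A + h) \<in> carr (dual (X i))"
        by (rule component_in[OF ns_add[OF SD A hD]])
      fix y assume "y \<in> x i ` {..<n}"
      then obtain k where k: "k < n" "y = x i k" by blast
      have "component i h y = 0" using h True k by (simp add: K_def component_def)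
      then show "component i (A + h) y = component i f y"
        using a_eq[OF k(1)] k(2) True by (simp add: component_linear comp)
    qed
    then show ?thesis using True by (simp add: comp)
  next
    case False
    have "A + h \<in> D" using ns_add[OF SD A] h by (simp add: K_def)
    from ns_nonneg[OF XD component_in[OF this]] show ?thesis
      using False ns_zero(2)[OF XD] by (simp add: comp)
  qed
  ultimately show ?thesis using A by blast
qed

definition \<phi> :: "nat \<Rightarrow> ((nat \<Rightarrow> 'v) \<Rightarrow> 'k) \<Rightarrow> (nat \<Rightarrow> 'v) \<Rightarrow> 'k" where
  "\<phi> n f = (SOME a. a \<in> D \<and> f - a \<in> K n \<and> (\<forall>h\<in>K n. \<forall>i. cnorm i a \<le> cnorm i (a + h)))"

lemma \<phi>:
  assumes "f \<in> D"
  shows "\<phi> n f \<in> D" "f - \<phi> n f \<in> K n" "h \<in> K n \<Longrightarrow> cnorm i (\<phi> n f) \<le> cnorm i (\<phi> n f + h)"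
  using someI_ex[OF componentwise_minimal[OF assms, of n, unfolded Bex_def]]
  unfolding \<phi>_def[symmetric] by blast+

sublocale l1_convex_projections D "\<lambda>i f. cnorm i f" dnorm K \<phi>
proof
  show "subspace D" by (rule subspace_dual[OF S])
  show "0 \<le> cnorm i f" if "f \<in> D" for f i
    by (rule ns_nonneg[OF XD component_in[OF that]])
  show "cnorm i (c *\<^sub>R f) = \<bar>c\<bar> * cnorm i f" if "f \<in> D" for f c i
    unfolding component_linear by (rule nrm_dual_scaleR[OF X component_in[OF that]])
  show "cnorm i (f + g) \<le> cnorm i f + cnorm i g" if "f \<in> D" "g \<in> D" for f g i
    unfolding component_linear
    by (rule ns_triangle[OF XD component_in[OF that(1)] component_in[OF that(2)]])
  show "(\<lambda>i. cnorm i f) sums dnorm f" if "f \<in> D" for f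
    by (rule cnorm_sums[OF that])
  show "\<exists>C\<ge>0. \<forall>i M. \<forall>f\<in>D. \<forall>g\<in>D. cnorm i f \<le> M \<longrightarrow> cnorm i g \<le> M \<longrightarrow>
        cnorm i (f - g) \<le> e * M + C * (M - cnorm i ((1/2) *\<^sub>R (f + g)))" if e: "0 < e" for e
  proof -
    obtain C where C: "C \<ge> 0" and *: "\<And>i M a b. a \<in> carr (dual (X i)) \<Longrightarrow> b \<in> carr (dual (X i)) \<Longrightarrow>
      nrm (dual (X i)) a \<le> M \<Longrightarrow> nrm (dual (X i)) b \<le> M \<Longrightarrow>
      nrm (dual (X i)) (a - b) \<le> e * M + C * (M - nrm (dual (X i)) ((1/2) *\<^sub>R (a + b)))"
      using conv[OF e] by metis
    show ?thesis
      unfolding component_linear using C *[OF component_in component_in] by blast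
  qed
  show "subspace (K n)" for n by (rule K_subspace)
  show "K n \<subseteq> D" for n by (auto simp: K_def)
  show "K (Suc n) \<subseteq> K n" for n by (auto simp: K_def)
  show "K 0 = D" by (simp add: K_def)
  show "\<phi> n f \<in> D" "f - \<phi> n f \<in> K n" if "f \<in> D" for f n
    using \<phi>[OF that] by blast+
  show "cnorm i (\<phi> n f) \<le> cnorm i (\<phi> n f + h)" if "f \<in> D" "h \<in> K n" for f h i n
    using \<phi>(3)[OF that] .
  show "dnorm f \<le> c" if f: "f \<in> D" and bound: "\<And>n. dnorm (\<phi> n f) \<le> c" for f c
  proof (rule dual_norm_least[OF S], rule field_le_epsilon)
    fix z and e :: real assume "z \<in> closed_unit_ball S" "0 < e"
    then have z: "z \<in> carr S" "nrm S z \<le> 1" by (auto simp: closed_unit_ball_def)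
    have c: "0 \<le> c" using bound[of 0] ns_nonneg[OF SD \<phi>(1)[OF f, of 0]] by linarith
    define e' where "e' = e / (dnorm f + c + 1)"
    have pos: "0 \<le> dnorm f + c" using c ns_nonneg[OF SD f] by simp
    have e': "e' > 0" "(dnorm f + c) * e' \<le> e"
      using \<open>0 < e\<close> pos by (auto simp: e'_def field_simps add_pos_nonneg)
    obtain y m where y: "y \<in> carr S" "nrm S (z - y) \<le> e'" and m: "\<forall>n\<ge>m. \<forall>g\<in>K n. g y = 0"
      using approx_in_span[OF z(1) e'(1)] by blast
    have "(f - \<phi> m f) y = 0" using m \<phi>(2)[OF f] by blast
    then have fy: "f y = \<phi> m f y" by simp
    have "nrm S y \<le> nrm S z + nrm S (z - y)"
      using ns_triangle_diff[OF S z(1) ns_diff[OF S z(1) y(1)]] by simp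
    then have "nrm S y \<le> 1 + e'" using z(2) y(2) by linarith
    then have "norm (f y) \<le> c * (1 + e')"
      using dual_norm_apply[OF S \<phi>(1)[OF f] y(1), of m] bound[of m] c ns_nonneg[OF S y(1)]
        mult_mono[of "dnorm (\<phi> m f)" c "nrm S y" "1 + e'"] fy by simp
    moreover have "norm (f z - f y) \<le> dnorm f * e'"
      using dual_norm_apply[OF S f ns_diff[OF S z(1) y(1)]] dual_diff[OF S f z(1) y(1)]
        mult_left_mono[OF y(2) ns_nonneg[OF SD f]] by simp
    ultimately show "norm (f z) \<le> c + e"
      using norm_triangle_ineq2[of "f z" "f y"] e'(2) by (simp add: algebra_simps)
  qed
qed

text \<open>
  At a point \<open>z\<close> the second alternative of \<open>retr_stable\<close> is handled by approximating \<open>z\<close> with a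
  vector \<open>y\<close> on which \<open>retr f\<close> and \<open>f\<close> agree; the remainder \<open>z - y\<close> is tested only against \<open>retr f - f0\<close>,
  whose norm is at most \<open>2\<close>, whereas \<open>f\<close> itself may be arbitrarily long.
\<close>

lemma retr_weak_star_continuous: "continuous_map (weak_star S) (weak_star S) retr"
proof (rule continuous_map_weak_starI[OF S])
  show "retr \<in> D \<rightarrow> D" using retr_in by blast
  fix f0 z and e :: real
  assume f0: "f0 \<in> D" and z: "z \<in> carr S" and e: "0 < e"
  have z0: "0 \<le> nrm S z" by (rule ns_nonneg[OF S z])
  define e' where "e' = e / (2 * (nrm S z + 1))"
  have e': "e' > 0" "e' * nrm S z < e"
    using e z0 by (auto simp: e'_def field_simps add_pos_nonneg)
  obtain y m where y: "y \<in> carr S" "nrm S (z - y) \<le> e/8" and m: "\<forall>n\<ge>m. \<forall>g\<in>K n. g y = 0"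
    using approx_in_span[OF z, of "e/8"] e by auto
  obtain n d where d: "d > 0" and stable: "\<And>f h. f \<in> D \<Longrightarrow> h \<in> D \<Longrightarrow> f0 - f - h \<in> K n \<Longrightarrow> dnorm h \<le> d \<Longrightarrow>
    dnorm (retr f0 - retr f) \<le> e' \<or> retr f0 = f0 \<and> f - retr f \<in> K m"
    using retr_stable[OF f0 e'(1), of m] by blast
  let ?P = "(\<lambda>(i, k). embed i (x i k)) ` ({..<n} \<times> {..<n})"
  have P: "finite ?P" "?P \<subseteq> carr S" by (auto intro: embed_in x_in)
  obtain d' where d': "d' > 0" and interp: "\<And>f. f \<in> D \<Longrightarrow> (\<forall>p\<in>?P. norm (f p) < d') \<Longrightarrow>
    \<exists>g\<in>D. dnorm g \<le> d \<and> (\<forall>p\<in>?P. g p = f p)"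
    using small_interpolation[OF S P d] by blast
  have "norm (retr f z - retr f0 z) < e"
    if f: "f \<in> D" and near: "\<forall>p\<in>insert y ?P. norm (f p - f0 p) < min d' (e/4)" for f
  proof -
    have rf: "retr f \<in> D" and rf0: "retr f0 \<in> D" using retr_in f f0 by auto
    have "\<forall>p\<in>?P. norm ((f0 - f) p) < d'"
      using near by (auto simp: norm_minus_commute)
    then obtain g where g: "g \<in> D" "dnorm g \<le> d" "\<forall>p\<in>?P. g p = (f0 - f) p"
      using interp[OF ns_diff[OF SD f0 f]] by blast
    have "f0 - f - g \<in> K n"
      using ns_diff[OF SD ns_diff[OF SD f0 f] g(1)] g(3) by (force simp: K_def)
    from stable[OF f g(1) this g(2)] show ?thesis
    proof
      assume "dnorm (retr f0 - retr f) \<le> e'"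
      then have "norm ((retr f0 - retr f) z) \<le> e' * nrm S z"
        using dual_norm_apply[OF S ns_diff[OF SD rf0 rf] z] mult_right_mono[OF _ z0] by fastforce
      then show ?thesis using e'(2) by (simp add: norm_minus_commute)
    next
      assume *: "retr f0 = f0 \<and> f - retr f \<in> K m"
      then have "(f - retr f) y = 0" using m by blast
      then have ry: "retr f y = f y" by simp
      have le2: "dnorm (retr f - f0) \<le> 2"
        using ns_triangle_diff[OF SD rf rf0] nn_retr_le[OF f] nn_retr_le[OF f0] * by simp
      have "norm ((retr f - f0) (z - y)) \<le> dnorm (retr f - f0) * nrm S (z - y)"
        by (rule dual_norm_apply[OF S ns_diff[OF SD rf f0] ns_diff[OF S z y(1)]])
      also have "\<dots> \<le> 2 * (e/8)"
        using le2 y(2) ns_nonneg[OF S ns_diff[OF S z y(1)]] by (intro mult_mono) auto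
      finally have far: "norm ((retr f - f0) (z - y)) \<le> e/4" by simp
      have "retr f z - f0 z = (retr f - f0) (z - y) + (f y - f0 y)"
        using dual_diff[OF S ns_diff[OF SD rf f0] z y(1)] ry by simp
      then have "norm (retr f z - f0 z) \<le> norm ((retr f - f0) (z - y)) + norm (f y - f0 y)"
        by (simp only: norm_triangle_ineq)
      also have "\<dots> < e" using far near e by fastforce
      finally show ?thesis using * by simp
    qed
  qed
  then show "\<exists>F d. finite F \<and> F \<subseteq> carr S \<and> 0 < d \<and>
      (\<forall>f\<in>D. (\<forall>y\<in>F. norm (f y - f0 y) < d) \<longrightarrow> norm (retr f z - retr f0 z) < e)"
    using P y(1) d' e by (intro exI[of _ "insert y ?P"] exI[of _ "min d' (e/4)"]) simp
qed

lemma usc_retraction: "dual_admits_usc_retraction S"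
proof -
  have "uniformly_continuous_map (norm_metric (dual S)) (norm_metric (dual S)) retr"
    unfolding uniformly_continuous_map_def norm_metric_simps[OF SD] ndist_def
    using retr_uniformly_continuous retr_in by (simp add: Pi_iff) (metis nn_minus)
  then show ?thesis
    unfolding dual_admits_usc_retraction_def
    using retr_in nn_retr_le retr_inside retr_weak_star_continuous
    by (intro exI[of _ retr]) (simp add: closed_unit_ball_def Pi_iff)
qed

end

section \<open>The retraction on the dual of the c0-sum\<close>

lemma c0_sum_dual_usc_retraction:
  fixes X :: "nat \<Rightarrow> ('k::{real_normed_field,banach}, 'v::ab_group_add) nspace"
  assumes X: "\<And>i. normed_space (X i)" and sep: "\<And>i. separable_nspace (X i)"
    and mod: "\<And>\<epsilon>. 0 < \<epsilon> \<Longrightarrow> \<epsilon> < 1 \<Longrightarrow> 0 < (INF i. modulus_of_convexity (dual (X i)) \<epsilon>)"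
  shows "dual_admits_usc_retraction (c0_sum X)"
proof -
  obtain x where x: "\<And>i k. x i k \<in> carr (X i)"
    "\<And>i v e. v \<in> carr (X i) \<Longrightarrow> 0 < e \<Longrightarrow> \<exists>k::nat. nrm (X i) (v - x i k) < e"
    using dense_sequence[OF X sep] by metis
  have half: "smul (dual (X i)) (1/2) f = (1/2) *\<^sub>R f" for i f
    using smul_dual_of_real[of "X i" "1/2" f] by simp
  interpret c0_predual X x
    using X x additive_convexity[of "\<lambda>i. dual (X i)", OF normed_space_dual[OF X] mod]
    by unfold_locales (simp_all only: half)
  show ?thesis by (rule usc_retraction)
qed

theorem theorem2p7:
  fixes X :: "nat \<Rightarrow> (real, 'a::ab_group_add) nspace"
    and Y :: "nat \<Rightarrow> (complex, 'b::ab_group_add) nspace"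
  shows
    "((\<forall>i. banach_space (X i)) \<and> (\<forall>i. separable_nspace (X i)) \<and>
      (\<forall>\<epsilon>. 0 < \<epsilon> \<and> \<epsilon> < 1 \<longrightarrow> (INF i. modulus_of_convexity (dual (X i)) \<epsilon>) > 0)
        \<longrightarrow> dual_admits_usc_retraction (c0_sum X)) \<and>
     ((\<forall>i. banach_space (Y i)) \<and> (\<forall>i. separable_nspace (Y i)) \<and>
      (\<forall>\<epsilon>. 0 < \<epsilon> \<and> \<epsilon> < 1 \<longrightarrow> (INF i. modulus_of_convexity (dual (Y i)) \<epsilon>) > 0)
        \<longrightarrow> dual_admits_usc_retraction (c0_sum Y))"
  using c0_sum_dual_usc_retraction[of X] c0_sum_dual_usc_retraction[of Y]
  by (simp add: banach_space_def)

end
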